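(* Let $f:\mathbb{R}^d\to\mathbb{R}$ be $L_0$-Lipschitz continuous, $L$-smooth and convex, with minimizer $x^*$. Run the deterministic one-point residual feedback algorithm from $x_1$ for $T$ iterations with smoothing parameter $\alpha>0$ and step size $\eta=\min\left\{\frac{\alpha}{4dL_0},\frac{1}{64dL}\right\}$. Then $$\frac1T\sum_{t=1}^T\mathbb{E}\big[f(x_t)-f(x^* )\big]\le\frac{\|x_1-x^*\|^2}{\eta T}+20\eta d^2L^2\alpha^2+\frac{16\eta dL_0^2}{T}+\frac{L\alpha^2}{2}.$$
   Context: $\|\cdot\|$ is the Euclidean norm on $\mathbb{R}^d$, $d\ge1$. A function $f$ is $L_0$-Lipschitz continuous ($L_0>0$) if $|f(x)-f(y)|\le L_0\|x-y\|$ for all $x,y$; it is $L$-smooth ($L>0$) if it is differentiable and $\|\nabla f(x)-\nabla f(y)\|\le L\|x-y\|$ for all $x,y$. $x^*$ denotes a minimizer of $f$ over $\mathbb{R}^d$. Deterministic one-point residual feedback algorithm: given an initial point $x_1\in\mathbb{R}^d$, step size $\eta>0$, smoothing parameter $\alpha>0$ and iteration number $T$, set $x_0=x_1$, let $u_0,u_1,\dots,u_T$ be independent and uniformly distributed on the unit sphere of $\mathbb{R}^d$, and for $t=1,\dots,T$ put $$g_t=d\cdot\frac{f(x_t+\alpha u_t)-f(x_{t-1}+\alpha u_{t-1})}{\alpha}\,u_t,\qquad x_{t+1}=x_t-\eta g_t .$$ Expectations are over all the $u_t$. *)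

theory Defs
  imports "HOL-Probability.Probability"
begin

definition L_smooth :: "real \<Rightarrow> ('a::euclidean_space \<Rightarrow> real) \<Rightarrow> bool" where
  "L_smooth L f \<longleftrightarrow>
     (\<exists>grad. (\<forall>x. GDERIV f x :> grad x) \<and> (\<forall>x y. norm (grad x - grad y) \<le> L * norm (x - y)))"

(* Normalized surface measure on the unit sphere, as the cone measure: a Borel set A gets the
   fraction of the unit ball's volume taken up by the points whose direction lies in A.  sgn x is
   the direction x / norm x; sgn 0 = 0 affects only a null set.  By prob_space_uniform_sphere,
   AE_uniform_sphere and uniform_sphere_orthogonal_invariant this is a probability measure carried by
   the sphere and invariant under all orthogonal transformations.
   In dimension 1 it is the uniform distribution on the two unit vectors. *)
definition uniform_sphere :: "'a::euclidean_space measure" where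
  "uniform_sphere = distr (uniform_measure lborel (cball 0 1)) borel sgn"

lemma cball_volume:
  "emeasure lborel (cball (0::'a::euclidean_space) 1) \<noteq> 0"
  "emeasure lborel (cball (0::'a::euclidean_space) 1) \<noteq> \<infinity>"
  using content_cball_pos[of 1 "0::'a"] emeasure_bounded_finite[of "cball (0::'a) 1"]
  by (auto simp: measure_def)

lemma prob_space_uniform_sphere: "prob_space (uniform_sphere :: 'a::euclidean_space measure)"
  unfolding uniform_sphere_def
  by (intro prob_space.prob_space_distr prob_space_uniform_measure cball_volume) simp

lemma AE_uniform_sphere: "AE x in (uniform_sphere :: 'a::euclidean_space measure). norm x = 1"
proof -
  have "AE x in lborel. x \<noteq> (0::'a)"
    by (rule AE_lborel_singleton)
  then have "AE x in uniform_measure lborel (cball (0::'a) 1). norm (sgn x) = 1"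
    by (intro AE_uniform_measureI) (auto simp: norm_sgn)
  then show ?thesis
    unfolding uniform_sphere_def by (subst AE_distr_iff) auto
qed

lemma emeasure_lborel_orthogonal_vimage:
  fixes T :: "'a::euclidean_space \<Rightarrow> 'a"
  assumes T: "orthogonal_transformation T" and A[measurable]: "A \<in> sets borel"
  shows "emeasure lborel (T -` A) = emeasure lborel A"
proof -
  let ?B = "cball (0::'a) 1"
  have lin: "linear T" using T by (rule orthogonal_transformation_linear)
  have [measurable]: "T \<in> borel_measurable borel"
    using lin by (intro borel_measurable_continuous_onI linear_continuous_on linear_conv_bounded_linear[THEN iffD1])
  have shift: "(\<integral>\<^sup>+y. g (c + y) \<partial>lborel) = (\<integral>\<^sup>+y. g y \<partial>lborel)"
    if [measurable]: "g \<in> borel_measurable borel" for g :: "'a \<Rightarrow> ennreal" and c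
    by (subst (2) lborel_distr_plus[of c, symmetric]) (subst nn_integral_distr, auto)
  define h where "h = (indicator A :: 'a \<Rightarrow> ennreal)"
  define k where "k = (indicator ?B :: 'a \<Rightarrow> ennreal)"
  have [measurable]: "h \<in> borel_measurable borel" "k \<in> borel_measurable borel"
    by (auto simp: h_def k_def intro!: borel_measurable_indicator)
  have [simp]: "(\<integral>\<^sup>+y. h y \<partial>lborel) = emeasure lborel A" "(\<integral>\<^sup>+y. k y \<partial>lborel) = emeasure lborel ?B"
    by (simp_all add: h_def k_def)
  have kT: "k (- T x) = k x" for x
    by (simp add: k_def indicator_def orthogonal_transformation_norm[OF T])
  have "T -` A \<in> sets borel"
    using measurable_sets[of T borel borel A] by simp
  then have "(\<integral>\<^sup>+x. h (T x) \<partial>lborel) = emeasure lborel (T -` A)"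
    by (simp add: h_def indicator_vimage[symmetric])
  then have "emeasure lborel (T -` A) * emeasure lborel ?B = (\<integral>\<^sup>+x. h (T x) * emeasure lborel ?B \<partial>lborel)"
    by (simp add: nn_integral_multc)
  also have "\<dots> = (\<integral>\<^sup>+x. \<integral>\<^sup>+y. h (T x) * k (- T x + y) \<partial>lborel \<partial>lborel)"
    using shift[of k] by (simp add: nn_integral_cmult del: add_uminus_conv_diff uminus_add_conv_diff)
  also have "\<dots> = (\<integral>\<^sup>+y. \<integral>\<^sup>+x. h (T x) * k (- T x + y) \<partial>lborel \<partial>lborel)"
    by (rule lborel_pair.Fubini') simp
  also have "\<dots> = (\<integral>\<^sup>+y. \<integral>\<^sup>+x. h (T x + y) * k x \<partial>lborel \<partial>lborel)"
  proof (rule nn_integral_cong)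
    fix y
    obtain b where b: "y = T b"
      using orthogonal_transformation_surj[OF T] by blast
    have "(\<integral>\<^sup>+x. h (T x) * k (- T x + y) \<partial>lborel) = (\<integral>\<^sup>+x. h (T (b + x)) * k (- T (b + x) + y) \<partial>lborel)"
      by (rule shift[symmetric]) simp
    also have "\<dots> = (\<integral>\<^sup>+x. h (T x + y) * k x \<partial>lborel)"
      by (intro nn_integral_cong) (simp add: linear_add[OF lin] b add.commute kT)
    finally show "(\<integral>\<^sup>+x. h (T x) * k (- T x + y) \<partial>lborel) = (\<integral>\<^sup>+x. h (T x + y) * k x \<partial>lborel)" .
  qed
  also have "\<dots> = (\<integral>\<^sup>+x. \<integral>\<^sup>+y. h (T x + y) * k x \<partial>lborel \<partial>lborel)"
    by (rule lborel_pair.Fubini') simp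
  also have "\<dots> = emeasure lborel A * emeasure lborel ?B"
    using shift[of h] by (simp add: nn_integral_multc nn_integral_cmult)
  finally show ?thesis
    using cball_volume[where ?'a = 'a] by (simp add: mult.commute[of _ "emeasure lborel (cball (0::'a) 1)"] ennreal_mult_cancel_left)
qed

lemma uniform_sphere_orthogonal_invariant:
  fixes T :: "'a::euclidean_space \<Rightarrow> 'a"
  assumes T: "orthogonal_transformation T"
  shows "distr uniform_sphere borel T = uniform_sphere"
proof -
  have lin: "linear T" using T by (rule orthogonal_transformation_linear)
  have [measurable]: "T \<in> borel_measurable borel"
    using lin by (intro borel_measurable_continuous_onI linear_continuous_on linear_conv_bounded_linear[THEN iffD1])
  show ?thesis
  proof (rule measure_eqI)
    fix A :: "'a set" assume "A \<in> sets (distr uniform_sphere borel T)"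
    then have A[measurable]: "A \<in> sets borel" by simp
    have meas: "sgn -` C \<in> sets borel" "T -` C \<in> sets borel" if "C \<in> sets borel" for C :: "'a set"
      using measurable_sets[OF _ that, of sgn borel] measurable_sets[OF _ that, of T borel] by auto
    have us: "emeasure uniform_sphere C
        = emeasure lborel (cball 0 1 \<inter> sgn -` C) / emeasure lborel (cball (0::'a) 1)"
      if C: "C \<in> sets borel" for C :: "'a set"
      unfolding uniform_sphere_def using C meas[OF C] by (subst emeasure_distr) auto
    have "cball 0 1 \<inter> sgn -` (T -` A) = T -` (cball 0 1 \<inter> sgn -` A)"
      by (auto simp: sgn_div_norm linear_cmul[OF lin] orthogonal_transformation_norm[OF T])
    then have "emeasure uniform_sphere (T -` A) = emeasure uniform_sphere A"
      using emeasure_lborel_orthogonal_vimage[OF T, of "cball 0 1 \<inter> sgn -` A"] meas[OF A]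
      by (simp only: us meas(2)[OF A] A) simp
    then show "emeasure (distr uniform_sphere borel T) A = emeasure uniform_sphere A"
      by (subst emeasure_distr) (simp_all add: uniform_sphere_def)
  qed (simp add: uniform_sphere_def)
qed

definition residual_grad ::
  "('a::euclidean_space \<Rightarrow> real) \<Rightarrow> real \<Rightarrow> 'a \<Rightarrow> 'a \<Rightarrow> 'a \<Rightarrow> 'a \<Rightarrow> 'a" where
  "residual_grad f \<alpha> x v x' v' =
     (real DIM('a) * ((f (x + \<alpha> *\<^sub>R v) - f (x' + \<alpha> *\<^sub>R v')) / \<alpha>)) *\<^sub>R v"

fun residual_iterate ::
  "('a::euclidean_space \<Rightarrow> real) \<Rightarrow> real \<Rightarrow> real \<Rightarrow> 'a \<Rightarrow> (nat \<Rightarrow> 'a) \<Rightarrow> nat \<Rightarrow> 'a" where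
  "residual_iterate f \<alpha> \<eta> x1 u 0 = x1"
| "residual_iterate f \<alpha> \<eta> x1 u (Suc 0) = x1"
| "residual_iterate f \<alpha> \<eta> x1 u (Suc (Suc n)) =
     residual_iterate f \<alpha> \<eta> x1 u (Suc n) -
     \<eta> *\<^sub>R residual_grad f \<alpha> (residual_iterate f \<alpha> \<eta> x1 u (Suc n)) (u (Suc n))
                         (residual_iterate f \<alpha> \<eta> x1 u n) (u n)"

end

theory Submission
  imports Defs
begin

text \<open>
  Write \<open>d\<close> for the dimension, \<open>c = L \<alpha>\<^sup>2 / 2\<close>, and, with expectations over all directions,
  \<open>R t = E |x t - xstar|\<^sup>2\<close>, \<open>D t = E |x (t + 1) - x t|\<^sup>2\<close>, \<open>n t = E |grad f (x t)|\<^sup>2\<close> and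
  \<open>\<delta> t = E (f (x t) - f xstar)\<close>.  The proof combines two recursions.

  Progress.  The direction \<open>u t\<close> is independent of everything that determines \<open>x t\<close> and of the
  subtracted old function value, which therefore contributes nothing to the mean of \<open>g t\<close>, as the
  sphere is centred.  What remains is \<open>(d / \<alpha>) E f (x + \<alpha> u) u\<close>, the gradient at \<open>x\<close> of the average
  of \<open>f\<close> over the ball of radius \<open>\<alpha>\<close> around \<open>x\<close>.  This average is convex, lies above \<open>f\<close>, and
  exceeds \<open>f xstar\<close> by at most \<open>c\<close> at \<open>xstar\<close>; so the mean of \<open>g t\<close> has inner product at least
  \<open>f (x t) - f xstar - c\<close> with \<open>x t - xstar\<close>, and \<open>R (t + 1) \<le> R t - 2 \<eta> (\<delta> t - c) + D t\<close>.  The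
  gradient of the ball average enters only through an inequality between a sphere integral and a
  ball integral of a convex function (\<open>convex_ball_difference_le_sphere\<close>), obtained from
  translation invariance of Lebesgue measure and a radial cutoff function that shrinks to the
  indicator of the ball.

  Noise.  The residual \<open>f (x t + \<alpha> u t) - f (x (t - 1) + \<alpha> u (t - 1))\<close> is the sum of two linear terms
  \<open>\<alpha> grad f \<bullet> u\<close>, the difference \<open>f (x t) - f (x (t - 1))\<close>, and a Taylor remainder of size
  \<open>L \<alpha>\<^sup>2\<close>.  Since \<open>E (u \<bullet> a)\<^sup>2 = |a|\<^sup>2 / d\<close>, the linear terms cost only a factor \<open>d\<close> instead of
  \<open>d\<^sup>2\<close>.  The difference is controlled by the previous step, and the condition
  \<open>\<eta> \<le> \<alpha> / (4 d L0)\<close> makes that feedback a contraction: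
  \<open>D t \<le> 4 \<eta>\<^sup>2 d (n t + n (t - 1)) + D (t - 1) / 4 + 4 \<eta>\<^sup>2 d\<^sup>2 L\<^sup>2 \<alpha>\<^sup>2\<close>.

  Finally \<open>n t \<le> 2 L \<delta> t\<close> by smoothness, and \<open>\<eta> \<le> 1 / (64 d L)\<close> lets the progress term absorb the
  gradient norms when both recursions are summed (\<open>averaged_descent_bound\<close>).
\<close>

section \<open>The uniform distribution on the sphere\<close>

lemma continuous_bounded_on_cball:
  fixes H :: "'b::euclidean_space \<Rightarrow> real"
  assumes H: "continuous_on UNIV H"
  obtains K where "\<And>z. norm z \<le> C \<Longrightarrow> \<bar>H z\<bar> \<le> K"
proof -
  have "compact (H ` cball 0 C)"
    by (intro compact_continuous_image continuous_on_subset[OF H]) auto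
  then show thesis
    using that by (force dest!: compact_imp_bounded simp: bounded_iff)
qed

text \<open>
  The source of integrability for the random quantities of the algorithm: almost surely every
  direction has norm 1, the iterates up to any fixed time stay in a fixed ball, and everything else is
  a continuous function of these.
\<close>

lemma integrable_continuous_of_AE_bounded:
  fixes Z :: "'w \<Rightarrow> 'b::euclidean_space" and H :: "'b \<Rightarrow> real"
  assumes M: "finite_measure M" and Z[measurable]: "Z \<in> borel_measurable M"
    and bnd: "AE \<omega> in M. norm (Z \<omega>) \<le> C" and H: "continuous_on UNIV H"
  shows "integrable M (\<lambda>\<omega>. H (Z \<omega>))"
proof -
  have [measurable]: "H \<in> borel_measurable borel"
    using H by (rule borel_measurable_continuous_onI)
  obtain K where K: "\<And>z. norm z \<le> C \<Longrightarrow> \<bar>H z\<bar> \<le> K"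
    using continuous_bounded_on_cball[OF H] by blast
  show ?thesis
    by (rule finite_measure.integrable_const_bound[OF M, of _ K])
      (use bnd in eventually_elim, auto intro: K)
qed

lemma sets_uniform_sphere [simp, measurable_cong]:
  "sets (uniform_sphere :: 'a::euclidean_space measure) = sets borel"
  by (simp add: uniform_sphere_def)

lemma space_uniform_sphere [simp]:
  "space (uniform_sphere :: 'a::euclidean_space measure) = UNIV"
  by (simp add: uniform_sphere_def)

lemma integrable_uniform_sphere:
  fixes h :: "'a::euclidean_space \<Rightarrow> real"
  assumes "continuous_on UNIV h"
  shows "integrable uniform_sphere h"
proof (rule integrable_continuous_of_AE_bounded[where Z = "\<lambda>x. x" and C = 1])
  show "finite_measure (uniform_sphere :: 'a measure)"
    using prob_space_uniform_sphere by (rule prob_space.finite_measure)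
  show "AE x in (uniform_sphere :: 'a measure). norm x \<le> 1"
    using AE_uniform_sphere by eventually_elim simp
qed (use assms in auto)

lemma integral_uniform_sphere_orthogonal:
  fixes h :: "'a::euclidean_space \<Rightarrow> real" and T :: "'a \<Rightarrow> 'a"
  assumes T: "orthogonal_transformation T" and h: "h \<in> borel_measurable borel"
  shows "(\<integral>u. h (T u) \<partial>uniform_sphere) = (\<integral>u. h u \<partial>uniform_sphere)"
proof -
  have T_meas: "T \<in> measurable uniform_sphere borel"
    using orthogonal_transformation_linear[OF T] unfolding measurable_cong_sets[OF sets_uniform_sphere refl]
    by (intro borel_measurable_continuous_onI linear_continuous_on linear_conv_bounded_linear[THEN iffD1])
  show ?thesis
    using integral_distr[OF T_meas h] uniform_sphere_orthogonal_invariant[OF T] by simp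
qed

lemma integral_uniform_sphere_inner:
  "(\<integral>u. u \<bullet> a \<partial>uniform_sphere) = (0::real)" for a :: "'a::euclidean_space"
  using integral_uniform_sphere_orthogonal[of "uminus" "\<lambda>u. u \<bullet> a"]
  by (simp add: orthogonal_transformation_def linear_uminus)

text \<open>
  The transformation is the reflection in the hyperplane orthogonal to \<open>a - b\<close>.
\<close>

lemma orthogonal_reflection_exists:
  fixes a b :: "'a::euclidean_space"
  assumes "norm a = norm b"
  obtains T where "orthogonal_transformation T" "T a = b"
proof
  define c where "c = a - b"
  define T where "T = (\<lambda>x. x - (2 * (x \<bullet> c) / (c \<bullet> c)) *\<^sub>R c)"
  show "orthogonal_transformation T"
    unfolding orthogonal_transformation_def
  proof (intro conjI allI)
    show "linear T"
      by (rule linearI) (simp_all add: T_def algebra_simps inner_add_left add_divide_distrib)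
    show "T v \<bullet> T w = v \<bullet> w" for v w
      by (cases "c = 0") (auto simp: T_def inner_diff_left inner_diff_right inner_commute field_simps)
  qed
  have "a \<bullet> a = b \<bullet> b"
    using assms by (simp add: dot_square_norm)
  then have "c \<bullet> c = 2 * (a \<bullet> c)"
    by (simp add: c_def inner_diff_left inner_diff_right inner_commute)
  then show "T a = b"
    by (cases "c = 0") (auto simp: T_def c_def)
qed

text \<open>
  By rotation invariance the integral depends on \<open>a\<close> only through its norm, so it is \<open>|a|\<^sup>2\<close> times
  the value at any basis vector; the values at the \<open>d\<close> basis vectors add up to \<open>E |u|\<^sup>2 = 1\<close>.  This
  factor \<open>1 / d\<close> is what makes the noise of the algorithm grow with \<open>d\<close> rather than \<open>d\<^sup>2\<close>.
\<close>

lemma integral_uniform_sphere_inner_square: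
  fixes a :: "'a::euclidean_space"
  shows "(\<integral>u. (u \<bullet> a)\<^sup>2 \<partial>uniform_sphere) = (norm a)\<^sup>2 / DIM('a)"
proof -
  define q where "q = (\<lambda>a::'a. \<integral>u. (u \<bullet> a)\<^sup>2 \<partial>uniform_sphere)"
  have q_eq: "q a = (norm a)\<^sup>2 * q b" if b: "b \<in> Basis" for b
  proof -
    have "norm a = norm (norm a *\<^sub>R b)"
      using b by simp
    then obtain T where T: "orthogonal_transformation T" "T a = norm a *\<^sub>R b"
      by (rule orthogonal_reflection_exists)
    have "u \<bullet> a = norm a * (T u \<bullet> b)" for u
    proof -
      have "u \<bullet> a = T u \<bullet> T a"
        using T(1) by (simp add: orthogonal_transformation_def)
      then show ?thesis by (simp add: T(2))
    qed
    then have "q a = (norm a)\<^sup>2 * (\<integral>u. (T u \<bullet> b)\<^sup>2 \<partial>uniform_sphere)"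
      by (simp add: q_def power_mult_distrib)
    then show ?thesis
      using integral_uniform_sphere_orthogonal[OF T(1), of "\<lambda>u. (u \<bullet> b)\<^sup>2"] by (simp add: q_def)
  qed
  have "(\<Sum>b\<in>Basis. q b) = (\<integral>u. (\<Sum>b\<in>Basis. (u \<bullet> b)\<^sup>2) \<partial>(uniform_sphere::'a measure))"
    unfolding q_def
    by (intro Bochner_Integration.integral_sum[symmetric] integrable_uniform_sphere continuous_intros)
  also have "\<dots> = (\<integral>u. 1 \<partial>(uniform_sphere::'a measure))"
  proof (rule integral_cong_AE)
    show "AE u in uniform_sphere. (\<Sum>b\<in>Basis. (u \<bullet> b)\<^sup>2) = (1::real)"
      using AE_uniform_sphere
    proof eventually_elim
      case (elim u)
      have "(norm u)\<^sup>2 = (\<Sum>b\<in>Basis. (u \<bullet> b)\<^sup>2)"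
        by (subst power2_norm_eq_inner, subst euclidean_inner) (simp add: power2_eq_square)
      then show ?case using elim by simp
    qed
  qed auto
  also have "\<dots> = 1"
    by (simp add: prob_space.prob_space[OF prob_space_uniform_sphere, simplified])
  finally have "(\<Sum>b\<in>Basis. q b) = 1" .
  moreover have "DIM('a) * q a = (norm a)\<^sup>2 * (\<Sum>b\<in>Basis. q b)"
    using q_eq by (simp add: sum_distrib_left flip: sum_constant)
  ultimately show ?thesis
    by (simp add: q_def field_simps)
qed

section \<open>Polar decomposition for the cone measure\<close>

lemma integral_uniform_sphere_cone:
  fixes q :: "'a::euclidean_space \<Rightarrow> real"
  assumes [measurable]: "q \<in> borel_measurable borel"
  shows "(\<integral>v. indicator (cball 0 1) v * q (sgn v) \<partial>lborel)
    = measure lborel (cball (0::'a) 1) * (\<integral>u. q u \<partial>uniform_sphere)"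
proof -
  let ?B = "cball (0::'a) 1"
  let ?V = "measure lborel ?B"
  have [measurable]: "?B \<in> sets borel" by simp
  have V: "?V > 0" by (simp add: content_cball_pos)
  have eV: "emeasure lborel ?B = ennreal ?V"
    using cball_volume[where ?'a = 'a] by (simp add: emeasure_eq_ennreal_measure top.not_eq_extremum)
  have unif: "uniform_measure lborel ?B = density lborel (\<lambda>x. ennreal (indicator ?B x / ?V))"
    unfolding uniform_measure_def eV
  proof (intro density_cong AE_I2)
    fix x :: 'a
    show "indicator ?B x / ennreal ?V = ennreal (indicator ?B x / ?V)"
      using V divide_ennreal[of 1 ?V] by (auto split: split_indicator)
  qed auto
  have "(\<integral>u. q u \<partial>uniform_sphere) = (\<integral>v. q (sgn v) \<partial>uniform_measure lborel ?B)"
    unfolding uniform_sphere_def by (rule integral_distr) auto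
  also have "\<dots> = (\<integral>v. (indicator ?B v / ?V) * q (sgn v) \<partial>lborel)"
    unfolding unif by (subst integral_density) auto
  also have "\<dots> = (\<integral>v. indicator ?B v * q (sgn v) \<partial>lborel) / ?V"
    by simp
  finally show ?thesis using V by (simp add: field_simps)
qed

lemma integral_cball_homogeneous:
  fixes q :: "'a::euclidean_space \<Rightarrow> real"
  assumes [measurable]: "q \<in> borel_measurable borel" and r: "r > 0"
  shows "(\<integral>v. indicator (cball 0 r) v * q (sgn v) \<partial>lborel)
    = r ^ DIM('a) * (\<integral>v. indicator (cball 0 1) v * q (sgn v) \<partial>lborel)"
proof -
  have [measurable]: "cball (0::'a) r \<in> sets borel" by simp
  have *: "indicator (cball 0 r) (r *\<^sub>R x) = (indicator (cball 0 1) x :: real)" for x :: 'a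
    using r by (auto simp: indicator_def)
  have "(\<integral>v. indicator (cball 0 r) v * q (sgn v) \<partial>lborel)
    = (\<integral>v. indicator (cball 0 r) v * q (sgn v)
          \<partial>density (distr lborel borel (\<lambda>x. 0 + r *\<^sub>R x)) (\<lambda>_. ennreal (\<bar>r\<bar> ^ DIM('a))))"
    using r by (subst lborel_affine[of r 0]) auto
  also have "\<dots> = r ^ DIM('a) * (\<integral>v. indicator (cball 0 1) v * q (sgn v) \<partial>lborel)"
    using r
    by (subst integral_density, simp_all)
      (subst integral_distr, simp_all add: sgn_scaleR *)
  finally show ?thesis .
qed

lemma integrable_cball_sgn:
  fixes q :: "'a::euclidean_space \<Rightarrow> real"
  assumes q: "continuous_on UNIV q"
  shows "integrable lborel (\<lambda>v. indicator (cball 0 r) v * q (sgn v))"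
proof -
  have [measurable]: "q \<in> borel_measurable borel"
    using q by (rule borel_measurable_continuous_onI)
  have [measurable]: "cball (0::'a) r \<in> sets borel" for r by simp
  obtain K where K: "\<And>z. norm z \<le> 1 \<Longrightarrow> \<bar>q z\<bar> \<le> K"
    using continuous_bounded_on_cball[OF q] by blast
  have K_sgn: "\<bar>q (sgn v)\<bar> \<le> K" for v :: 'a
    by (rule K) (simp add: norm_sgn)
  show ?thesis
  proof (rule Bochner_Integration.integrable_bound)
    show "integrable lborel (\<lambda>v::'a. K * indicator (cball 0 r) v)"
      using borel_integrable_compact[of "cball (0::'a) r" "\<lambda>_. K"] by (simp add: mult.commute)
    show "AE v in lborel. norm (indicator (cball 0 r) v * q (sgn v)) \<le> norm (K * indicator (cball 0 r) v)"
      using K_sgn by (auto split: split_indicator intro: order_trans[OF _ abs_ge_self])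
  qed measurable
qed

text \<open>
  A thin shell around the unit sphere carries the sphere integral with weight
  \<open>(1 + \<epsilon>) ^ d - 1\<close>, which behaves like \<open>d \<epsilon>\<close>: the factor \<open>d\<close> of the gradient estimator originates
  here.
\<close>

lemma integral_shell_homogeneous:
  fixes q :: "'a::euclidean_space \<Rightarrow> real"
  assumes q: "continuous_on UNIV q" and \<epsilon>: "\<epsilon> > 0"
  shows "integrable lborel (\<lambda>v. indicator (cball 0 (1 + \<epsilon>) - cball 0 1) v * q (sgn v))"
    and "(\<integral>v. indicator (cball 0 (1 + \<epsilon>) - cball 0 1) v * q (sgn v) \<partial>lborel)
      = ((1 + \<epsilon>) ^ DIM('a) - 1) * measure lborel (cball (0::'a) 1) * (\<integral>u. q u \<partial>uniform_sphere)"
proof -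
  have [measurable]: "q \<in> borel_measurable borel"
    using q by (rule borel_measurable_continuous_onI)
  have [measurable]: "cball (0::'a) r \<in> sets borel" for r by simp
  have split: "indicator (cball 0 (1 + \<epsilon>) - cball 0 1) v * q (sgn v)
    = indicator (cball 0 (1 + \<epsilon>)) v * q (sgn v) - indicator (cball 0 1) v * q (sgn v)" for v :: 'a
    using \<epsilon> by (auto split: split_indicator)
  note int = integrable_cball_sgn[OF q]
  show "integrable lborel (\<lambda>v. indicator (cball 0 (1 + \<epsilon>) - cball 0 1) v * q (sgn v))"
    unfolding split by (intro Bochner_Integration.integrable_diff int)
  show "(\<integral>v. indicator (cball 0 (1 + \<epsilon>) - cball 0 1) v * q (sgn v) \<partial>lborel)
      = ((1 + \<epsilon>) ^ DIM('a) - 1) * measure lborel (cball (0::'a) 1) * (\<integral>u. q u \<partial>uniform_sphere)"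
    unfolding split Bochner_Integration.integral_diff[OF int int]
    using \<epsilon> integral_cball_homogeneous[of q "1 + \<epsilon>"] integral_uniform_sphere_cone[of q]
    by (simp add: left_diff_distrib)
qed

section \<open>A radial cutoff function\<close>

text \<open>
  Equal to 1 on the unit ball and to 0 beyond radius \<open>1 + \<epsilon>\<close>, linear in the radius between.  It is
  Lipschitz, so that difference quotients of integrals against it can be passed to the limit, and its
  gradient is concentrated on the shell.
\<close>

definition cutoff :: "real \<Rightarrow> 'a::euclidean_space \<Rightarrow> real" where
  "cutoff \<epsilon> v = max 0 (min 1 ((1 + \<epsilon> - norm v) / \<epsilon>))"

lemma cutoff_range: "0 \<le> cutoff \<epsilon> v" "cutoff \<epsilon> v \<le> 1"
  by (auto simp: cutoff_def)

lemma cutoff_eq_1: "\<epsilon> > 0 \<Longrightarrow> norm v \<le> 1 \<Longrightarrow> cutoff \<epsilon> v = 1"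
  by (auto simp: cutoff_def field_simps)

lemma cutoff_eq_0: "\<epsilon> > 0 \<Longrightarrow> 1 + \<epsilon> \<le> norm v \<Longrightarrow> cutoff \<epsilon> v = 0"
  by (auto simp: cutoff_def field_simps)

lemma cutoff_lipschitz:
  assumes "\<epsilon> > 0"
  shows "\<bar>cutoff \<epsilon> v - cutoff \<epsilon> v'\<bar> \<le> norm (v - v') / \<epsilon>"
proof -
  have "\<bar>cutoff \<epsilon> v - cutoff \<epsilon> v'\<bar> \<le> \<bar>(1 + \<epsilon> - norm v) / \<epsilon> - (1 + \<epsilon> - norm v') / \<epsilon>\<bar>"
    unfolding cutoff_def by linarith
  also have "\<dots> = \<bar>norm v - norm v'\<bar> / \<epsilon>"
    using assms by (simp flip: diff_divide_distrib)
  also have "\<dots> \<le> norm (v - v') / \<epsilon>"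
    using assms by (intro divide_right_mono norm_triangle_ineq3) auto
  finally show ?thesis .
qed

lemma continuous_on_cutoff [continuous_intros]:
  "\<epsilon> > 0 \<Longrightarrow> continuous_on S g \<Longrightarrow> continuous_on S (\<lambda>x. cutoff \<epsilon> (g x))"
  unfolding cutoff_def by (intro continuous_intros) auto

text \<open>
  On the two spheres excluded here the cutoff has a kink; they are null sets, which
  suffices for dominated convergence.
\<close>

lemma cutoff_directional_derivative:
  fixes v w :: "'a::euclidean_space"
  assumes \<epsilon>: "\<epsilon> > 0" and v: "norm v \<noteq> 1" "norm v \<noteq> 1 + \<epsilon>"
  shows "((\<lambda>s. cutoff \<epsilon> (v + s *\<^sub>R w)) has_real_derivative
    - (indicator (cball 0 (1 + \<epsilon>) - cball 0 1) v * (sgn v \<bullet> w) / \<epsilon>)) (at 0)"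
proof -
  have lim: "((\<lambda>s. norm (v + s *\<^sub>R w)) \<longlongrightarrow> norm v) (nhds 0)"
    by (auto intro!: tendsto_eq_intros filterlim_ident)
  consider "norm v < 1" | "1 < norm v" "norm v < 1 + \<epsilon>" | "1 + \<epsilon> < norm v"
    using v by linarith
  then show ?thesis
  proof cases
    case 1
    have "eventually (\<lambda>s. cutoff \<epsilon> (v + s *\<^sub>R w) = 1) (nhds 0)"
      using order_tendstoD(2)[OF lim 1] by eventually_elim (simp add: cutoff_eq_1 \<epsilon>)
    then show ?thesis
      using 1 by (subst DERIV_cong_ev[OF refl _ refl]) auto
  next
    case 3
    have "eventually (\<lambda>s. cutoff \<epsilon> (v + s *\<^sub>R w) = 0) (nhds 0)"
      using order_tendstoD(1)[OF lim 3] by eventually_elim (simp add: cutoff_eq_0 \<epsilon>)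
    then show ?thesis
      using 3 by (subst DERIV_cong_ev[OF refl _ refl]) auto
  next
    case 2
    have "v \<noteq> 0" using 2 by auto
    have ev: "eventually (\<lambda>s. cutoff \<epsilon> (v + s *\<^sub>R w) = (1 + \<epsilon> - norm (v + s *\<^sub>R w)) / \<epsilon>) (nhds 0)"
      using order_tendstoD(1)[OF lim 2(1)] order_tendstoD(2)[OF lim 2(2)]
      by eventually_elim (use \<epsilon> in \<open>auto simp: cutoff_def field_simps\<close>)
    have "((\<lambda>s. norm (v + s *\<^sub>R w)) has_derivative (\<lambda>s. s *\<^sub>R w \<bullet> sgn (v + 0 *\<^sub>R w))) (at 0)"
      by (rule has_derivative_compose[of "\<lambda>s. v + s *\<^sub>R w", OF _ has_derivative_norm])
        (auto intro!: derivative_eq_intros simp: \<open>v \<noteq> 0\<close>)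
    then have "((\<lambda>s. norm (v + s *\<^sub>R w)) has_real_derivative (sgn v \<bullet> w)) (at 0)"
      unfolding has_field_derivative_def
      by (rule has_derivative_eq_rhs) (simp add: fun_eq_iff inner_commute mult.commute)
    then have "((\<lambda>s. (1 + \<epsilon> - norm (v + s *\<^sub>R w)) / \<epsilon>) has_real_derivative - ((sgn v \<bullet> w) / \<epsilon>)) (at 0)"
      using \<epsilon> by (auto intro!: derivative_eq_intros)
    then show ?thesis
      using 2 by (subst DERIV_cong_ev[OF refl ev refl]) auto
  qed
qed

lemma cutoff_difference_quotient:
  fixes v w :: "'a::euclidean_space"
  assumes \<epsilon>: "\<epsilon> > 0" and v: "norm v \<noteq> 1" "norm v \<noteq> 1 + \<epsilon>"
  shows "(\<lambda>n. (cutoff \<epsilon> v - cutoff \<epsilon> (v + inverse (real (Suc n)) *\<^sub>R w)) / inverse (real (Suc n)))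
    \<longlonglongrightarrow> indicator (cball 0 (1 + \<epsilon>) - cball 0 1) v * (sgn v \<bullet> w) / \<epsilon>"
proof -
  have "(\<lambda>s. (cutoff \<epsilon> (v + s *\<^sub>R w) - cutoff \<epsilon> v) / s) \<midarrow>0\<rightarrow>
      - (indicator (cball 0 (1 + \<epsilon>) - cball 0 1) v * (sgn v \<bullet> w) / \<epsilon>)"
    using cutoff_directional_derivative[OF assms] by (simp add: DERIV_def)
  moreover have "filterlim (\<lambda>n. inverse (real (Suc n))) (at 0) sequentially"
    unfolding filterlim_at using LIMSEQ_inverse_real_of_nat by auto
  ultimately have "(\<lambda>n. (cutoff \<epsilon> (v + inverse (real (Suc n)) *\<^sub>R w) - cutoff \<epsilon> v) / inverse (real (Suc n)))
     \<longlonglongrightarrow> - (indicator (cball 0 (1 + \<epsilon>) - cball 0 1) v * (sgn v \<bullet> w) / \<epsilon>)"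
    by (rule filterlim_compose)
  from tendsto_minus[OF this] show ?thesis
    by (simp only: minus_divide_left minus_diff_eq minus_minus)
qed

section \<open>A sphere integral that dominates a difference of ball integrals\<close>

lemma integrable_compactly_supported:
  fixes g :: "'a::euclidean_space \<Rightarrow> real"
  assumes g: "continuous_on UNIV g" and supp: "\<And>v. R < norm v \<Longrightarrow> g v = 0"
  shows "integrable lborel g"
proof -
  have "integrable lborel (\<lambda>v. indicator (cball 0 R) v *\<^sub>R g v)"
    by (intro borel_integrable_compact continuous_on_subset[OF g]) auto
  also have "(\<lambda>v. indicator (cball 0 R) v *\<^sub>R g v) = g"
    using supp by (auto simp: fun_eq_iff split: split_indicator)
  finally show ?thesis .
qed

lemma integral_lborel_translate:
  fixes g :: "'a::euclidean_space \<Rightarrow> real"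
  assumes "g \<in> borel_measurable borel"
  shows "(\<integral>v. g (c + v) \<partial>lborel) = (\<integral>v. g v \<partial>lborel)"
  by (subst (2) lborel_distr_plus[of c, symmetric]) (simp add: integral_distr assms)

lemma AE_lborel_norm_neq: "AE v in lborel. norm (v::'a::euclidean_space) \<noteq> r"
proof (rule AE_I[where N = "sphere 0 r"])
  have "sphere (0::'a) r \<in> null_sets lborel"
    using negligible_sphere[of "0::'a" r] by (simp add: negligible_iff_null_sets null_sets_completion_iff)
  then show "emeasure lborel (sphere (0::'a) r) = 0" "sphere (0::'a) r \<in> sets lborel"
    by auto
qed auto

text \<open>
  Integration by parts, with convexity in place of differentiability of \<open>h\<close>.  Convexity gives
  \<open>h v - h (v - w) \<le> (h v - h (v - t w)) / t\<close> for \<open>0 < t \<le> 1\<close>; translation invariance moves the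
  difference quotient from \<open>h\<close> onto the cutoff, and there the limit \<open>t \<rightarrow> 0\<close> exists.
\<close>

lemma convex_cutoff_integral_le:
  fixes h :: "'a::euclidean_space \<Rightarrow> real"
  assumes conv: "convex_on UNIV h" and cont: "continuous_on UNIV h" and \<epsilon>: "\<epsilon> > 0"
  shows "(\<integral>v. cutoff \<epsilon> v * (h v - h (v - w)) \<partial>lborel)
    \<le> (\<integral>v. h v * (indicator (cball 0 (1 + \<epsilon>) - cball 0 1) v * (sgn v \<bullet> w) / \<epsilon>) \<partial>lborel)"
proof -
  have [measurable]: "h \<in> borel_measurable borel" "cutoff \<epsilon> \<in> borel_measurable (borel :: 'a measure)"
    using cont \<epsilon> by (auto intro!: borel_measurable_continuous_onI continuous_intros)
  have [measurable]: "cball (0::'a) r \<in> sets borel" for r by simp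
  have cont_shift: "continuous_on UNIV (\<lambda>v. h (v - c))" for c
    by (rule continuous_on_compose2[OF cont]) (auto intro!: continuous_intros)
  define t where "t = (\<lambda>n. inverse (real (Suc n)))"
  have t: "0 < t n" "t n \<le> 1" for n
    by (auto simp: t_def field_simps)
  define s where "s = (\<lambda>n v. h v * ((cutoff \<epsilon> v - cutoff \<epsilon> (v + t n *\<^sub>R w)) / t n))"
  let ?R = "1 + \<epsilon> + norm w"
  have supp: "cutoff \<epsilon> v = 0" "cutoff \<epsilon> (v + t n *\<^sub>R w) = 0" if "?R < norm v" for n and v :: 'a
  proof -
    have "norm (t n *\<^sub>R w) \<le> norm w"
      using t[of n] by (simp add: mult_left_le_one_le)
    moreover have "norm v \<le> norm (v + t n *\<^sub>R w) + norm (t n *\<^sub>R w)"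
      using norm_triangle_ineq4[of "v + t n *\<^sub>R w" "t n *\<^sub>R w"] by simp
    ultimately have "1 + \<epsilon> \<le> norm v" "1 + \<epsilon> \<le> norm (v + t n *\<^sub>R w)"
      using that norm_ge_zero[of w] by linarith+
    then show "cutoff \<epsilon> v = 0" "cutoff \<epsilon> (v + t n *\<^sub>R w) = 0"
      using cutoff_eq_0[OF \<epsilon>] by blast+
  qed
  have int1: "integrable lborel (\<lambda>v. cutoff \<epsilon> v * h (v - c))" for c
  proof (rule integrable_compactly_supported[where R = ?R])
    show "continuous_on UNIV (\<lambda>v. cutoff \<epsilon> v * h (v - c))"
      by (rule continuous_on_mult[OF continuous_on_cutoff[OF \<epsilon> continuous_on_id] cont_shift])
  qed (simp add: supp(1))
  have int2: "integrable lborel (\<lambda>v. cutoff \<epsilon> (v + t n *\<^sub>R w) * h v)" for n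
  proof (rule integrable_compactly_supported[where R = ?R])
    show "continuous_on UNIV (\<lambda>v. cutoff \<epsilon> (v + t n *\<^sub>R w) * h v)"
      by (rule continuous_on_mult[OF continuous_on_cutoff[OF \<epsilon>] cont]) (auto intro!: continuous_intros)
  qed (simp add: supp(2))
  have step: "(\<integral>v. cutoff \<epsilon> v * (h v - h (v - w)) \<partial>lborel) \<le> (\<integral>v. s n v \<partial>lborel)" for n
  proof -
    have t_s: "t n * s n v = cutoff \<epsilon> v * h v - cutoff \<epsilon> (v + t n *\<^sub>R w) * h v" for v
    proof -
      have "t n * s n v = h v * (cutoff \<epsilon> v - cutoff \<epsilon> (v + t n *\<^sub>R w))"
        using t(1)[of n] by (simp add: s_def)
      then show ?thesis by (simp only: right_diff_distrib mult.commute)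
    qed
    have "t n * (\<integral>v. cutoff \<epsilon> v * (h v - h (v - w)) \<partial>lborel)
        = (\<integral>v. t n * (cutoff \<epsilon> v * (h v - h (v - w))) \<partial>lborel)"
      by simp
    also have "\<dots> \<le> (\<integral>v. cutoff \<epsilon> v * (h v - h (v - t n *\<^sub>R w)) \<partial>lborel)"
    proof (rule integral_mono)
      show "integrable lborel (\<lambda>v. t n * (cutoff \<epsilon> v * (h v - h (v - w))))"
        "integrable lborel (\<lambda>v. cutoff \<epsilon> v * (h v - h (v - t n *\<^sub>R w)))"
        using int1[of 0] int1[of w] int1[of "t n *\<^sub>R w"] by (simp_all add: right_diff_distrib)
      fix v :: 'a
      have "h ((1 - t n) *\<^sub>R v + t n *\<^sub>R (v - w)) \<le> (1 - t n) * h v + t n * h (v - w)"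
        using t[of n] by (intro convex_onD[OF conv]) auto
      moreover have "(1 - t n) *\<^sub>R v + t n *\<^sub>R (v - w) = v - t n *\<^sub>R w"
        by (simp add: algebra_simps)
      ultimately have "t n * (h v - h (v - w)) \<le> h v - h (v - t n *\<^sub>R w)"
        by (simp add: algebra_simps)
      then have "cutoff \<epsilon> v * (t n * (h v - h (v - w))) \<le> cutoff \<epsilon> v * (h v - h (v - t n *\<^sub>R w))"
        by (intro mult_left_mono cutoff_range)
      then show "t n * (cutoff \<epsilon> v * (h v - h (v - w))) \<le> cutoff \<epsilon> v * (h v - h (v - t n *\<^sub>R w))"
        by (simp add: mult_ac)
    qed
    also have "\<dots> = (\<integral>v. cutoff \<epsilon> v * h v \<partial>lborel) - (\<integral>v. cutoff \<epsilon> v * h (v - t n *\<^sub>R w) \<partial>lborel)"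
      using int1[of 0] int1[of "t n *\<^sub>R w"] by (simp add: right_diff_distrib)
    also have "(\<integral>v. cutoff \<epsilon> v * h (v - t n *\<^sub>R w) \<partial>lborel) = (\<integral>v. cutoff \<epsilon> (v + t n *\<^sub>R w) * h v \<partial>lborel)"
      using integral_lborel_translate[of "\<lambda>v. cutoff \<epsilon> v * h (v - t n *\<^sub>R w)" "t n *\<^sub>R w"]
      by (simp add: add.commute)
    also have "(\<integral>v. cutoff \<epsilon> v * h v \<partial>lborel) - \<dots> = (\<integral>v. t n * s n v \<partial>lborel)"
      unfolding t_s using int1[of 0] int2[of n]
      by (subst Bochner_Integration.integral_diff) auto
    finally show ?thesis
      using t[of n] by simp
  qed
  have "(\<lambda>n. \<integral>v. s n v \<partial>lborel)
    \<longlonglongrightarrow> (\<integral>v. h v * (indicator (cball 0 (1 + \<epsilon>) - cball 0 1) v * (sgn v \<bullet> w) / \<epsilon>) \<partial>lborel)"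
  proof (rule integral_dominated_convergence)
    show "integrable lborel (\<lambda>v. indicator (cball 0 ?R) v *\<^sub>R (\<bar>h v\<bar> * (norm w / \<epsilon>)))"
    proof (rule borel_integrable_compact[OF compact_cball])
      show "continuous_on (cball 0 ?R) (\<lambda>v. \<bar>h v\<bar> * (norm w / \<epsilon>))"
        by (rule continuous_on_mult_right[OF continuous_on_rabs[OF continuous_on_subset[OF cont subset_UNIV]]])
    qed
    show "AE v in lborel. (\<lambda>n. s n v) \<longlonglongrightarrow> h v * (indicator (cball 0 (1 + \<epsilon>) - cball 0 1) v * (sgn v \<bullet> w) / \<epsilon>)"
      using AE_lborel_norm_neq[of 1] AE_lborel_norm_neq[of "1 + \<epsilon>"]
      by eventually_elim
        (unfold s_def t_def, intro tendsto_mult tendsto_const cutoff_difference_quotient \<epsilon>)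
    show "AE v in lborel. norm (s n v) \<le> indicator (cball 0 ?R) v *\<^sub>R (\<bar>h v\<bar> * (norm w / \<epsilon>))" for n
    proof (rule AE_I2)
      fix v :: 'a
      have "\<bar>(cutoff \<epsilon> v - cutoff \<epsilon> (v + t n *\<^sub>R w)) / t n\<bar> \<le> norm w / \<epsilon>"
      proof -
        have "\<bar>cutoff \<epsilon> v - cutoff \<epsilon> (v + t n *\<^sub>R w)\<bar> \<le> (norm w / \<epsilon>) * t n"
          using cutoff_lipschitz[OF \<epsilon>, of v "v + t n *\<^sub>R w"] t(1)[of n] by (simp add: mult.commute)
        then show ?thesis
          using t(1)[of n] by (simp add: pos_divide_le_eq)
      qed
      then have "\<bar>s n v\<bar> \<le> \<bar>h v\<bar> * (norm w / \<epsilon>)"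
        unfolding s_def abs_mult by (rule mult_left_mono) simp
      moreover have "s n v = 0" if "?R < norm v"
        using supp[OF that] by (simp add: s_def)
      ultimately show "norm (s n v) \<le> indicator (cball 0 ?R) v *\<^sub>R (\<bar>h v\<bar> * (norm w / \<epsilon>))"
        by (cases "norm v \<le> ?R") auto
    qed
  qed (unfold s_def, measurable)
  then show ?thesis
    by (rule LIMSEQ_le_const) (simp add: step)
qed

lemma power_difference_quotient:
  "(\<lambda>n. ((1 + inverse (real (Suc n))) ^ d - 1) / inverse (real (Suc n))) \<longlonglongrightarrow> real d"
proof -
  have "((\<lambda>x::real. (1 + x) ^ d) has_real_derivative real d) (at 0)"
    by (auto intro!: derivative_eq_intros)
  then have "(\<lambda>x::real. ((1 + x) ^ d - 1) / x) \<midarrow>0\<rightarrow> real d"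
    by (simp add: DERIV_def)
  moreover have "filterlim (\<lambda>n. inverse (real (Suc n))) (at 0) sequentially"
    unfolding filterlim_at using LIMSEQ_inverse_real_of_nat by auto
  ultimately show ?thesis
    by (rule filterlim_compose)
qed

text \<open>
  The inequality form of the divergence theorem on the ball for a convex \<open>h\<close>: the right-hand side
  is the derivative at 0 of \<open>s \<mapsto> \<integral> h (v + s w)\<close> over the ball, which by convexity dominates the
  backward difference on the left.  It follows from
  \<open>convex_cutoff_integral_le\<close> as the cutoff shrinks to the indicator of the ball, since on a thin
  shell a Lipschitz function is nearly equal to its value at the radial projection to the sphere.
\<close>

lemma convex_ball_difference_le_sphere:
  fixes h :: "'a::euclidean_space \<Rightarrow> real"
  assumes conv: "convex_on UNIV h" and lip: "K-lipschitz_on UNIV h"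
  shows "(\<integral>v. indicator (cball 0 1) v * (h v - h (v - w)) \<partial>lborel)
    \<le> DIM('a) * measure lborel (cball (0::'a) 1) * (\<integral>u. h u * (u \<bullet> w) \<partial>uniform_sphere)"
proof -
  have cont: "continuous_on UNIV h"
    using lip by (rule lipschitz_on_continuous_on)
  have lipD: "\<bar>h a - h b\<bar> \<le> K * norm (a - b)" for a b
    using lipschitz_onD[OF lip, of a b] by (simp add: dist_norm)
  define k where "k = (\<lambda>v. h v - h (v - w))"
  have cont_k: "continuous_on UNIV k"
    unfolding k_def
    by (intro continuous_on_diff cont continuous_on_compose2[OF cont]) (auto intro!: continuous_intros)
  define q where "q = (\<lambda>u. h u * (u \<bullet> w))"
  have cont_q: "continuous_on UNIV q"
    unfolding q_def by (intro continuous_on_mult cont) (auto intro!: continuous_intros)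
  have [measurable]: "h \<in> borel_measurable borel"
    using cont by (rule borel_measurable_continuous_onI)
  have [measurable]: "cball (0::'a) r \<in> sets borel" for r by simp
  have k_le: "\<bar>k v\<bar> \<le> K * norm w" for v
    using lipD[of v "v - w"] by (simp add: k_def)
  let ?V = "measure lborel (cball (0::'a) 1)"
  define I where "I = (\<integral>v. indicator (cball 0 1) v * k v \<partial>lborel)"
  define S where "S = (\<integral>u. q u \<partial>uniform_sphere)"
  define \<rho> where "\<rho> = (\<lambda>\<epsilon>::real. (1 + \<epsilon>) ^ DIM('a) - 1)"
  \<comment> \<open>The factor \<open>\<rho> \<epsilon> / \<epsilon>\<close> tends to \<open>d\<close> and the error term vanishes as \<open>\<epsilon>\<close> tends to 0.\<close>
  have bound: "I \<le> \<rho> \<epsilon> / \<epsilon> * (?V * S) + 2 * (K * norm w) * ?V * \<rho> \<epsilon>" if \<epsilon>: "\<epsilon> > 0" for \<epsilon>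
  proof -
    define sh where "sh = (indicator (cball 0 (1 + \<epsilon>) - cball 0 1) :: 'a \<Rightarrow> real)"
    have [measurable]: "sh \<in> borel_measurable borel"
      unfolding sh_def by measurable
    have sh: "integrable lborel sh" "(\<integral>v. sh v \<partial>lborel) = \<rho> \<epsilon> * ?V"
      using integral_shell_homogeneous[of "\<lambda>_::'a. 1", OF _ \<epsilon>]
        prob_space.prob_space[OF prob_space_uniform_sphere, where ?'a1 = 'a]
      by (simp_all add: sh_def \<rho>_def)
    have shq: "integrable lborel (\<lambda>v. sh v * q (sgn v))" "(\<integral>v. sh v * q (sgn v) \<partial>lborel) = \<rho> \<epsilon> * ?V * S"
      using integral_shell_homogeneous[OF cont_q \<epsilon>] by (simp_all add: sh_def \<rho>_def S_def)
    have int_k: "integrable lborel (\<lambda>v. indicator (cball 0 1) v * k v)"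
      using borel_integrable_compact[OF compact_cball continuous_on_subset[OF cont_k subset_UNIV], of 0 1]
      by simp
    have int_ck: "integrable lborel (\<lambda>v. cutoff \<epsilon> v * k v)"
    proof (rule integrable_compactly_supported[where R = "1 + \<epsilon>"])
      show "continuous_on UNIV (\<lambda>v. cutoff \<epsilon> v * k v)"
        by (rule continuous_on_mult[OF continuous_on_cutoff[OF \<epsilon> continuous_on_id] cont_k])
    qed (simp add: cutoff_eq_0 \<epsilon>)
    have "I - (K * norm w) * (\<rho> \<epsilon> * ?V) = (\<integral>v. indicator (cball 0 1) v * k v - (K * norm w) * sh v \<partial>lborel)"
      unfolding I_def sh(2)[symmetric] using int_k sh(1) by simp
    also have "\<dots> \<le> (\<integral>v. cutoff \<epsilon> v * k v \<partial>lborel)"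
    proof (rule integral_mono)
      show "integrable lborel (\<lambda>v. indicator (cball 0 1) v * k v - (K * norm w) * sh v)"
        using int_k sh(1) by simp
      fix v :: 'a
      have "\<bar>cutoff \<epsilon> v * k v\<bar> \<le> 1 * (K * norm w)"
        unfolding abs_mult using cutoff_range[of \<epsilon> v] k_le by (intro mult_mono) auto
      then show "indicator (cball 0 1) v * k v - (K * norm w) * sh v \<le> cutoff \<epsilon> v * k v"
        using cutoff_eq_1[OF \<epsilon>, of v] cutoff_eq_0[OF \<epsilon>, of v]
        by (auto simp: sh_def indicator_def)
    qed (rule int_ck)
    also have "\<dots> \<le> (\<integral>v. h v * (sh v * (sgn v \<bullet> w) / \<epsilon>) \<partial>lborel)"
      using convex_cutoff_integral_le[OF conv cont \<epsilon>, of w] by (simp add: k_def sh_def)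
    also have "\<dots> \<le> (\<integral>v. sh v * q (sgn v) / \<epsilon> + (K * norm w) * sh v \<partial>lborel)"
    proof (rule integral_mono)
      have inner_le: "\<bar>sgn v \<bullet> w\<bar> \<le> norm w" for v :: 'a
        using Cauchy_Schwarz_ineq2[of "sgn v" w] by (auto simp: norm_sgn split: if_splits)
      show "integrable lborel (\<lambda>v. sh v * q (sgn v) / \<epsilon> + (K * norm w) * sh v)"
        using shq(1) sh(1) by simp
      show "integrable lborel (\<lambda>v. h v * (sh v * (sgn v \<bullet> w) / \<epsilon>))"
      proof (rule Bochner_Integration.integrable_bound)
        show "integrable lborel (\<lambda>v. indicator (cball 0 (1 + \<epsilon>)) v *\<^sub>R (\<bar>h v\<bar> * (norm w / \<epsilon>)))"
          by (rule borel_integrable_compact[OF compact_cball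
            continuous_on_mult_right[OF continuous_on_rabs[OF continuous_on_subset[OF cont subset_UNIV]]]])
        show "AE v in lborel. norm (h v * (sh v * (sgn v \<bullet> w) / \<epsilon>))
          \<le> norm (indicator (cball 0 (1 + \<epsilon>)) v *\<^sub>R (\<bar>h v\<bar> * (norm w / \<epsilon>)))"
        proof (rule AE_I2)
          fix v :: 'a
          have "\<bar>h v\<bar> * (\<bar>sgn v \<bullet> w\<bar> / \<epsilon>) \<le> \<bar>h v\<bar> * (norm w / \<epsilon>)"
            using inner_le \<epsilon> by (intro mult_left_mono divide_right_mono) auto
          then show "norm (h v * (sh v * (sgn v \<bullet> w) / \<epsilon>))
            \<le> norm (indicator (cball 0 (1 + \<epsilon>)) v *\<^sub>R (\<bar>h v\<bar> * (norm w / \<epsilon>)))"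
            using \<epsilon> by (auto simp: sh_def abs_mult indicator_def)
        qed
      qed measurable
      fix v :: 'a
      show "h v * (sh v * (sgn v \<bullet> w) / \<epsilon>) \<le> sh v * q (sgn v) / \<epsilon> + (K * norm w) * sh v"
      \<comment> \<open>In the shell, \<open>h (sgn v)\<close> for \<open>h v\<close> costs at most \<open>K \<epsilon>\<close>, which compensates the slope \<open>1 / \<epsilon>\<close> of the cutoff.\<close>
      proof (cases "1 < norm v \<and> norm v \<le> 1 + \<epsilon>")
        case True
        have "v - sgn v = (1 - inverse (norm v)) *\<^sub>R v"
          by (simp add: sgn_div_norm algebra_simps)
        then have "norm (v - sgn v) = \<bar>1 - inverse (norm v)\<bar> * norm v"
          by simp
        also have "\<dots> = norm v - 1"
        proof -
          have "0 \<le> 1 - inverse (norm v)"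
            using True by (auto simp: inverse_le_1_iff)
          then have "\<bar>1 - inverse (norm v)\<bar> * norm v = norm v - inverse (norm v) * norm v"
            by (simp only: abs_of_nonneg left_diff_distrib mult_1_left)
          also have "inverse (norm v) * norm v = 1"
            using True by (intro left_inverse) auto
          finally show ?thesis .
        qed
        finally have "norm (v - sgn v) \<le> \<epsilon>"
          using True by simp
        then have "\<bar>h v - h (sgn v)\<bar> \<le> K * \<epsilon>"
          using lipD[of v "sgn v"] lipschitz_on_nonneg[OF lip]
          by (meson mult_left_mono order_trans)
        then have "\<bar>(h v - h (sgn v)) * (sgn v \<bullet> w)\<bar> \<le> (K * \<epsilon>) * norm w"
          unfolding abs_mult using inner_le lipschitz_on_nonneg[OF lip] \<epsilon> by (intro mult_mono) auto
        then have "h v * (sgn v \<bullet> w) \<le> q (sgn v) + (K * \<epsilon>) * norm w"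
          by (simp add: q_def left_diff_distrib)
        then have "h v * (sgn v \<bullet> w) / \<epsilon> \<le> (q (sgn v) + (K * \<epsilon>) * norm w) / \<epsilon>"
          using \<epsilon> by (intro divide_right_mono) auto
        also have "\<dots> = q (sgn v) / \<epsilon> + K * norm w"
          using \<epsilon> by (simp add: field_simps)
        finally show ?thesis
          using True by (simp add: sh_def)
      qed (auto simp: sh_def)
    qed
    also have "\<dots> = \<rho> \<epsilon> * ?V * S / \<epsilon> + (K * norm w) * (\<rho> \<epsilon> * ?V)"
      using shq sh by simp
    finally show ?thesis
      by (simp add: algebra_simps)
  qed
  define e where "e = (\<lambda>n. inverse (real (Suc n)))"
  have e: "e n > 0" for n by (simp add: e_def)
  have quot: "(\<lambda>n. \<rho> (e n) / e n) \<longlonglongrightarrow> real DIM('a)"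
    unfolding \<rho>_def e_def by (rule power_difference_quotient)
  have "(\<lambda>n. \<rho> (e n) / e n * e n) \<longlonglongrightarrow> real DIM('a) * 0"
    by (rule tendsto_mult[OF quot]) (unfold e_def, rule LIMSEQ_inverse_real_of_nat)
  moreover have "\<rho> (e n) / e n * e n = \<rho> (e n)" for n
    using e[of n] by simp
  ultimately have rho: "(\<lambda>n. \<rho> (e n)) \<longlonglongrightarrow> 0"
    by simp
  have "(\<lambda>n. \<rho> (e n) / e n * (?V * S) + 2 * (K * norm w) * ?V * \<rho> (e n))
      \<longlonglongrightarrow> DIM('a) * (?V * S) + 2 * (K * norm w) * ?V * 0"
    by (intro tendsto_add tendsto_mult quot rho tendsto_const)
  then have "I \<le> DIM('a) * (?V * S) + 2 * (K * norm w) * ?V * 0"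
    by (rule LIMSEQ_le_const) (use bound[OF e] in blast)
  then show ?thesis
    by (simp add: I_def S_def k_def q_def mult.assoc)
qed

text \<open>
  Pair each \<open>v\<close> with \<open>- v\<close>, whose midpoint is the centre.
\<close>

lemma convex_ball_average_ge_center:
  fixes h :: "'a::euclidean_space \<Rightarrow> real"
  assumes conv: "convex_on UNIV h" and cont: "continuous_on UNIV h"
  shows "measure lborel (cball (0::'a) 1) * h 0 \<le> (\<integral>v. indicator (cball 0 1) v * h v \<partial>lborel)"
proof -
  let ?B = "cball (0::'a) 1"
  have [measurable]: "h \<in> borel_measurable borel"
    using cont by (rule borel_measurable_continuous_onI)
  have [measurable]: "?B \<in> sets borel" by simp
  have int: "integrable lborel (\<lambda>v. indicator ?B v * h v)"
    using borel_integrable_compact[OF compact_cball continuous_on_subset[OF cont subset_UNIV], of 0 1]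
    by simp
  have ind_neg: "indicator ?B (- v) = (indicator ?B v :: real)" for v
    by (simp add: indicator_def)
  have refl_distr: "distr lborel borel (uminus :: 'a \<Rightarrow> 'a) = lborel"
  proof -
    have "lborel = density (distr lborel borel (\<lambda>x. - x :: 'a)) (\<lambda>_. 1)"
      using lborel_affine[of "-1" "0::'a"] by simp
    then show ?thesis
      by (simp add: density_1)
  qed
  have "(\<integral>v. indicator ?B v * h v \<partial>lborel)
      = (\<integral>v. indicator ?B v * h v \<partial>distr lborel borel (uminus :: 'a \<Rightarrow> 'a))"
    by (simp add: refl_distr)
  also have "\<dots> = (\<integral>v. indicator ?B (- v) * h (- v) \<partial>lborel)"
    by (rule integral_distr) auto
  finally have eq: "(\<integral>v. indicator ?B v * h v \<partial>lborel) = (\<integral>v. indicator ?B v * h (- v) \<partial>lborel)"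
    by (simp add: ind_neg)
  have cont_neg: "continuous_on UNIV (\<lambda>v. h (- v))"
    by (rule continuous_on_compose2[OF cont]) (auto intro!: continuous_intros)
  have int': "integrable lborel (\<lambda>v. indicator ?B v * h (- v))"
    using borel_integrable_compact[OF compact_cball continuous_on_subset[OF cont_neg subset_UNIV], of 0 1]
    by simp
  have int1: "integrable lborel (\<lambda>v. indicator ?B v * (2 * h 0))"
    using borel_integrable_compact[OF compact_cball continuous_on_const, of "0::'a" 1 "2 * h 0"] by simp
  have "measure lborel ?B * (2 * h 0) = (\<integral>v. indicator ?B v * (2 * h 0) \<partial>lborel)"
    by simp
  also have "\<dots> \<le> (\<integral>v. indicator ?B v * h v + indicator ?B v * h (- v) \<partial>lborel)"
  proof (rule integral_mono[OF int1])
    show "integrable lborel (\<lambda>v. indicator ?B v * h v + indicator ?B v * h (- v))"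
      using int int' by simp
    fix v :: 'a
    have "h ((1 - 1 / 2) *\<^sub>R v + (1 / 2) *\<^sub>R (- v)) \<le> (1 - 1 / 2) * h v + (1 / 2) * h (- v)"
      by (rule convex_onD[OF conv]) auto
    then have "2 * h 0 \<le> h v + h (- v)"
      by (simp add: algebra_simps)
    then show "indicator ?B v * (2 * h 0) \<le> indicator ?B v * h v + indicator ?B v * h (- v)"
      by (auto simp: indicator_def)
  qed
  also have "\<dots> = 2 * (\<integral>v. indicator ?B v * h v \<partial>lborel)"
    using int int' eq by simp
  finally show ?thesis by simp
qed

text \<open>
  The previous two lemmas applied to the rescaled function \<open>v \<mapsto> f (x + \<alpha> v)\<close> and the displacement
  \<open>(x - y) / \<alpha>\<close>, which takes the ball around \<open>x\<close> to the ball around \<open>y\<close>.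
\<close>

lemma sphere_gradient_estimate_ge:
  fixes f :: "'a::euclidean_space \<Rightarrow> real"
  assumes conv: "convex_on UNIV f" and lip: "K-lipschitz_on UNIV f" and \<alpha>: "\<alpha> > 0"
    and upper: "\<And>v. norm v \<le> 1 \<Longrightarrow> f (y + \<alpha> *\<^sub>R v) \<le> c"
  shows "f x - c \<le> DIM('a) * (\<integral>u. f (x + \<alpha> *\<^sub>R u) * (u \<bullet> (x - y)) / \<alpha> \<partial>uniform_sphere)"
proof -
  let ?B = "cball (0::'a) 1"
  let ?V = "measure lborel ?B"
  define h where "h = (\<lambda>v. f (x + \<alpha> *\<^sub>R v))"
  define w where "w = (x - y) /\<^sub>R \<alpha>"
  have V: "?V > 0" by (simp add: content_cball_pos)
  have cont: "continuous_on UNIV f"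
    using lip by (rule lipschitz_on_continuous_on)
  have h_conv: "convex_on UNIV h"
  proof (rule convex_onI)
    fix t :: real and a b :: 'a assume t: "0 < t" "t < 1"
    have "x + \<alpha> *\<^sub>R ((1 - t) *\<^sub>R a + t *\<^sub>R b) = (1 - t) *\<^sub>R (x + \<alpha> *\<^sub>R a) + t *\<^sub>R (x + \<alpha> *\<^sub>R b)"
      by (simp add: algebra_simps)
    then show "h ((1 - t) *\<^sub>R a + t *\<^sub>R b) \<le> (1 - t) * h a + t * h b"
      unfolding h_def using convex_onD[OF conv, of t "x + \<alpha> *\<^sub>R a" "x + \<alpha> *\<^sub>R b"] t by simp
  qed auto
  have h_lip: "(K * \<alpha>)-lipschitz_on UNIV h"
  proof (rule lipschitz_onI)
    fix a b :: 'a
    have "dist (x + \<alpha> *\<^sub>R a) (x + \<alpha> *\<^sub>R b) = \<alpha> * dist a b"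
      using \<alpha> by (simp add: dist_norm flip: scaleR_diff_right)
    then show "dist (h a) (h b) \<le> K * \<alpha> * dist a b"
      unfolding h_def using lipschitz_onD[OF lip, of "x + \<alpha> *\<^sub>R a" "x + \<alpha> *\<^sub>R b"] by simp
  qed (use \<alpha> lipschitz_on_nonneg[OF lip] in simp)
  have h_cont: "continuous_on UNIV h"
    using h_lip by (rule lipschitz_on_continuous_on)
  have h_shift: "h (v - w) = f (y + \<alpha> *\<^sub>R v)" for v
    using \<alpha> by (simp add: h_def w_def algebra_simps)
  have h_shift_cont: "continuous_on UNIV (\<lambda>v. h (v - w))"
    by (rule continuous_on_compose2[OF h_cont]) (auto intro!: continuous_intros)
  have int: "integrable lborel (\<lambda>v. indicator ?B v * h v)"
    "integrable lborel (\<lambda>v. indicator ?B v * h (v - w))"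
    using borel_integrable_compact[OF compact_cball continuous_on_subset[OF h_cont subset_UNIV], of 0 1]
      borel_integrable_compact[OF compact_cball continuous_on_subset[OF h_shift_cont subset_UNIV], of 0 1]
    by simp_all
  have intc: "integrable lborel (\<lambda>v. indicator ?B v * c)"
    using borel_integrable_compact[OF compact_cball continuous_on_const, of "0::'a" 1 c] by simp
  have "(\<integral>v. indicator ?B v * h (v - w) \<partial>lborel) \<le> (\<integral>v. indicator ?B v * c \<partial>lborel)"
    by (rule integral_mono[OF int(2) intc]) (auto simp: indicator_def h_shift upper)
  also have "\<dots> = ?V * c"
    by simp
  finally have "?V * (f x - c) \<le> (\<integral>v. indicator ?B v * h v \<partial>lborel) - (\<integral>v. indicator ?B v * h (v - w) \<partial>lborel)"
    using convex_ball_average_ge_center[OF h_conv h_cont] by (simp add: h_def right_diff_distrib)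
  also have "\<dots> = (\<integral>v. indicator ?B v * (h v - h (v - w)) \<partial>lborel)"
    using int by (simp add: right_diff_distrib)
  also have "\<dots> \<le> DIM('a) * ?V * (\<integral>u. h u * (u \<bullet> w) \<partial>uniform_sphere)"
    by (rule convex_ball_difference_le_sphere[OF h_conv h_lip])
  finally have "?V * (f x - c) \<le> ?V * (DIM('a) * (\<integral>u. h u * (u \<bullet> w) \<partial>uniform_sphere))"
    by (simp add: mult_ac)
  then have "f x - c \<le> DIM('a) * (\<integral>u. h u * (u \<bullet> w) \<partial>uniform_sphere)"
    using V by (simp only: mult_le_cancel_left_pos)
  moreover have "h u * (u \<bullet> w) = f (x + \<alpha> *\<^sub>R u) * (u \<bullet> (x - y)) / \<alpha>" for u
    by (simp add: h_def w_def divide_inverse)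
  ultimately show ?thesis by simp
qed

text \<open>
  The old value \<open>f (x' + \<alpha> v')\<close> is constant in \<open>v\<close> and multiplies a function of mean zero, so the
  residual estimator has the same mean as the estimator without feedback.
\<close>

lemma expectation_residual_grad_inner_ge:
  fixes f :: "'a::euclidean_space \<Rightarrow> real"
  assumes conv: "convex_on UNIV f" and lip: "K-lipschitz_on UNIV f" and \<alpha>: "\<alpha> > 0"
    and upper: "\<And>v. norm v \<le> 1 \<Longrightarrow> f (y + \<alpha> *\<^sub>R v) \<le> c"
  shows "f x - c \<le> (\<integral>v. residual_grad f \<alpha> x v x' v' \<bullet> (x - y) \<partial>uniform_sphere)"
proof -
  have cont: "continuous_on UNIV f"
    using lip by (rule lipschitz_on_continuous_on)
  have cont': "continuous_on UNIV (\<lambda>v. f (x + \<alpha> *\<^sub>R v))"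
    by (rule continuous_on_compose2[OF cont]) (auto intro!: continuous_intros)
  have int1: "integrable uniform_sphere (\<lambda>v. f (x + \<alpha> *\<^sub>R v) * (v \<bullet> (x - y)) / \<alpha>)"
    by (intro integrable_uniform_sphere continuous_on_divide continuous_on_mult cont')
      (use \<alpha> in \<open>auto intro!: continuous_intros\<close>)
  have int2: "integrable uniform_sphere (\<lambda>v. v \<bullet> (x - y))"
    by (intro integrable_uniform_sphere continuous_intros)
  have "residual_grad f \<alpha> x v x' v' \<bullet> (x - y)
    = DIM('a) * (f (x + \<alpha> *\<^sub>R v) * (v \<bullet> (x - y)) / \<alpha>)
      - DIM('a) * f (x' + \<alpha> *\<^sub>R v') / \<alpha> * (v \<bullet> (x - y))" for v
    by (simp add: residual_grad_def diff_divide_distrib algebra_simps)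
  then have "(\<integral>v. residual_grad f \<alpha> x v x' v' \<bullet> (x - y) \<partial>uniform_sphere)
    = DIM('a) * (\<integral>v. f (x + \<alpha> *\<^sub>R v) * (v \<bullet> (x - y)) / \<alpha> \<partial>uniform_sphere)"
    using int1 int2 integral_uniform_sphere_inner[of "x - y"]
    by (simp only: Bochner_Integration.integral_diff Bochner_Integration.integrable_mult_right
        Bochner_Integration.integral_mult_right_zero)
  then show ?thesis
    using sphere_gradient_estimate_ge[OF assms, of x] by simp
qed

section \<open>Smooth functions\<close>

text \<open>
  Along the segment, \<open>f\<close> minus the claimed quadratic upper bound has nonpositive derivative by
  Cauchy-Schwarz and the Lipschitz gradient.
\<close>

lemma smooth_upper_bound:
  fixes f :: "'a::real_inner \<Rightarrow> real"
  assumes grad: "\<And>x. GDERIV f x :> g x" and lip: "\<And>x y. norm (g x - g y) \<le> L * norm (x - y)"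
  shows "f (x + h) \<le> f x + g x \<bullet> h + L / 2 * (norm h)\<^sup>2"
proof -
  define \<phi> where "\<phi> = (\<lambda>t. f (x + t *\<^sub>R h) - t * (g x \<bullet> h) - L / 2 * (norm h)\<^sup>2 * t\<^sup>2)"
  have "\<phi> 1 \<le> \<phi> 0"
  proof (rule DERIV_nonpos_imp_nonincreasing[of 0 1 \<phi>])
    fix t :: real assume t: "0 \<le> t" "t \<le> 1"
    have "((\<lambda>t. f (x + t *\<^sub>R h)) has_derivative (\<lambda>s. (s *\<^sub>R h) \<bullet> g (x + t *\<^sub>R h))) (at t)"
      by (rule has_derivative_compose[of "\<lambda>t. x + t *\<^sub>R h", OF _ grad[unfolded gderiv_def]])
        (auto intro!: derivative_eq_intros)
    then have f_deriv: "((\<lambda>t. f (x + t *\<^sub>R h)) has_real_derivative (g (x + t *\<^sub>R h) \<bullet> h)) (at t)"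
      unfolding has_field_derivative_def
      by (rule has_derivative_eq_rhs) (simp add: fun_eq_iff inner_commute mult.commute)
    have "(\<phi> has_real_derivative (g (x + t *\<^sub>R h) \<bullet> h - g x \<bullet> h - L * (norm h)\<^sup>2 * t)) (at t)"
      unfolding \<phi>_def by (auto intro!: derivative_eq_intros f_deriv)
    moreover have "g (x + t *\<^sub>R h) \<bullet> h - g x \<bullet> h \<le> L * (norm h)\<^sup>2 * t"
    proof -
      have "(g (x + t *\<^sub>R h) - g x) \<bullet> h \<le> norm (g (x + t *\<^sub>R h) - g x) * norm h"
        by (rule norm_cauchy_schwarz)
      also have "\<dots> \<le> (L * norm (t *\<^sub>R h)) * norm h"
        using lip[of "x + t *\<^sub>R h" x] by (intro mult_right_mono) auto
      finally show ?thesis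
        using t by (simp add: inner_diff_left power2_eq_square mult_ac)
    qed
    ultimately show "\<exists>y. (\<phi> has_real_derivative y) (at t) \<and> y \<le> 0"
      by (intro exI conjI) auto
  qed auto
  then show ?thesis
    by (simp add: \<phi>_def)
qed

lemma smooth_taylor_bound:
  fixes f :: "'a::real_inner \<Rightarrow> real"
  assumes grad: "\<And>x. GDERIV f x :> g x" and lip: "\<And>x y. norm (g x - g y) \<le> L * norm (x - y)"
  shows "\<bar>f (x + h) - f x - g x \<bullet> h\<bar> \<le> L / 2 * (norm h)\<^sup>2"
proof -
  have "- f (x + h) \<le> - f x + (- g x) \<bullet> h + L / 2 * (norm h)\<^sup>2"
  proof (rule smooth_upper_bound)
    show "GDERIV (\<lambda>x. - f x) x :> - g x" for x
      by (rule GDERIV_minus[OF grad])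
    show "norm (- g x - - g y) \<le> L * norm (x - y)" for x y
      using lip[of x y] by (simp add: norm_minus_commute)
  qed
  with smooth_upper_bound[OF assms, of x h] show ?thesis
    unfolding abs_le_iff inner_minus_left by linarith
qed

text \<open>
  One gradient step of length \<open>1 / L\<close> decreases \<open>f\<close> by at least \<open>|g x|\<^sup>2 / (2 L)\<close>, but not below
  \<open>m\<close>.
\<close>

lemma smooth_gradient_norm_le:
  fixes f :: "'a::real_inner \<Rightarrow> real"
  assumes L: "L > 0"
    and grad: "\<And>x. GDERIV f x :> g x" and lip: "\<And>x y. norm (g x - g y) \<le> L * norm (x - y)"
    and min: "\<And>z. m \<le> f z"
  shows "(norm (g x))\<^sup>2 \<le> 2 * L * (f x - m)"
proof -
  have "m \<le> f x + g x \<bullet> (- (1 / L) *\<^sub>R g x) + L / 2 * (norm (- (1 / L) *\<^sub>R g x))\<^sup>2"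
    using smooth_upper_bound[OF grad lip] min order_trans by blast
  also have "\<dots> = f x - (norm (g x))\<^sup>2 / (2 * L)"
    using L by (simp add: power2_norm_eq_inner[symmetric] power_mult_distrib power_divide field_simps power2_eq_square)
  finally show ?thesis
    using L by (simp add: field_simps)
qed

section \<open>The residual gradient and the iterates\<close>

lemma square_sum4_le: "(a + b + c + d)\<^sup>2 \<le> 4 * (a\<^sup>2 + b\<^sup>2 + c\<^sup>2 + d\<^sup>2)" for a b c d :: real
proof -
  have "4 * (a\<^sup>2 + b\<^sup>2 + c\<^sup>2 + d\<^sup>2) - (a + b + c + d)\<^sup>2
    = (a - b)\<^sup>2 + (a - c)\<^sup>2 + (a - d)\<^sup>2 + (b - c)\<^sup>2 + (b - d)\<^sup>2 + (c - d)\<^sup>2"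
    by (simp add: power2_eq_square algebra_simps)
  then show ?thesis
    by (smt (verit) zero_le_power2)
qed

text \<open>
  The residual divided by \<open>\<alpha>\<close> is split into two linear terms, the change of \<open>f\<close> between the two
  base points, and the difference of two Taylor remainders, which is at most
  \<open>L \<alpha>\<^sup>2\<close>.  The linear terms are kept in the form \<open>v \<bullet> g x\<close> because only after averaging over \<open>v\<close> do they gain the factor \<open>1 / d\<close>.
\<close>

lemma residual_grad_norm_le:
  fixes f :: "'a::euclidean_space \<Rightarrow> real"
  assumes grad: "\<And>x. GDERIV f x :> g x" and glip: "\<And>x y. norm (g x - g y) \<le> L * norm (x - y)"
    and lip: "L0-lipschitz_on UNIV f" and \<alpha>: "\<alpha> > 0"
    and v: "norm v = 1" and v': "norm v' = 1"
  shows "(norm (residual_grad f \<alpha> x v x' v'))\<^sup>2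
    \<le> 4 * (real DIM('a))\<^sup>2 * ((v \<bullet> g x)\<^sup>2 + (v' \<bullet> g x')\<^sup>2 + (L0 / \<alpha>)\<^sup>2 * (norm (x - x'))\<^sup>2 + L\<^sup>2 * \<alpha>\<^sup>2)"
proof -
  define r where "r = (f (x + \<alpha> *\<^sub>R v) - f x - g x \<bullet> (\<alpha> *\<^sub>R v)) - (f (x' + \<alpha> *\<^sub>R v') - f x' - g x' \<bullet> (\<alpha> *\<^sub>R v'))"
  have "\<bar>r\<bar> \<le> L / 2 * (norm (\<alpha> *\<^sub>R v))\<^sup>2 + L / 2 * (norm (\<alpha> *\<^sub>R v'))\<^sup>2"
    unfolding r_def
    using smooth_taylor_bound[OF grad glip, of x "\<alpha> *\<^sub>R v"] smooth_taylor_bound[OF grad glip, of x' "\<alpha> *\<^sub>R v'"]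
    by linarith
  also have "\<dots> = L * \<alpha>\<^sup>2"
    by (simp add: v v')
  finally have "\<bar>r / \<alpha>\<bar> \<le> L * \<alpha>"
    using \<alpha> by (simp add: power2_eq_square pos_divide_le_eq mult.assoc)
  then have "(r / \<alpha>)\<^sup>2 \<le> (L * \<alpha>)\<^sup>2"
    using abs_le_square_iff[of "r / \<alpha>" "L * \<alpha>"] by linarith
  then have r: "(r / \<alpha>)\<^sup>2 \<le> L\<^sup>2 * \<alpha>\<^sup>2"
    by (simp only: power_mult_distrib)
  have "\<bar>(f x - f x') / \<alpha>\<bar> \<le> L0 / \<alpha> * norm (x - x')"
    using lipschitz_onD[OF lip, of x x'] \<alpha> by (simp add: dist_norm divide_right_mono)
  then have "((f x - f x') / \<alpha>)\<^sup>2 \<le> (L0 / \<alpha> * norm (x - x'))\<^sup>2"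
    using abs_le_square_iff[of "(f x - f x') / \<alpha>" "L0 / \<alpha> * norm (x - x')"] by linarith
  then have fd: "((f x - f x') / \<alpha>)\<^sup>2 \<le> (L0 / \<alpha>)\<^sup>2 * (norm (x - x'))\<^sup>2"
    by (simp only: power_mult_distrib)
  have "(f (x + \<alpha> *\<^sub>R v) - f (x' + \<alpha> *\<^sub>R v')) / \<alpha>
    = (v \<bullet> g x) + (- (v' \<bullet> g x')) + (f x - f x') / \<alpha> + r / \<alpha>"
    using \<alpha> by (simp add: r_def field_simps inner_commute)
  then have "((f (x + \<alpha> *\<^sub>R v) - f (x' + \<alpha> *\<^sub>R v')) / \<alpha>)\<^sup>2
    \<le> 4 * ((v \<bullet> g x)\<^sup>2 + (- (v' \<bullet> g x'))\<^sup>2 + ((f x - f x') / \<alpha>)\<^sup>2 + (r / \<alpha>)\<^sup>2)"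
    using square_sum4_le by metis
  also have "\<dots> \<le> 4 * ((v \<bullet> g x)\<^sup>2 + (v' \<bullet> g x')\<^sup>2 + (L0 / \<alpha>)\<^sup>2 * (norm (x - x'))\<^sup>2 + L\<^sup>2 * \<alpha>\<^sup>2)"
    using r fd by simp
  finally have "(real DIM('a))\<^sup>2 * ((f (x + \<alpha> *\<^sub>R v) - f (x' + \<alpha> *\<^sub>R v')) / \<alpha>)\<^sup>2
    \<le> (real DIM('a))\<^sup>2 * (4 * ((v \<bullet> g x)\<^sup>2 + (v' \<bullet> g x')\<^sup>2 + (L0 / \<alpha>)\<^sup>2 * (norm (x - x'))\<^sup>2 + L\<^sup>2 * \<alpha>\<^sup>2))"
    by (intro mult_left_mono) auto
  moreover have "(norm (residual_grad f \<alpha> x v x' v'))\<^sup>2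
    = (real DIM('a))\<^sup>2 * ((f (x + \<alpha> *\<^sub>R v) - f (x' + \<alpha> *\<^sub>R v')) / \<alpha>)\<^sup>2"
    by (simp only: residual_grad_def norm_scaleR v power_mult_distrib power2_abs power_one mult_1_right)
  ultimately show ?thesis
    by (simp only: mult_ac)
qed

lemma norm_gradient_step:
  "(norm (x - \<eta> *\<^sub>R v - y))\<^sup>2 = (norm (x - y))\<^sup>2 - 2 * \<eta> * (v \<bullet> (x - y)) + (norm (\<eta> *\<^sub>R v))\<^sup>2"
  for x y v :: "'a::real_inner"
  unfolding power2_norm_eq_inner
  by (simp add: inner_diff_left inner_diff_right inner_commute algebra_simps)

text \<open>
  The iterate at time \<open>t\<close> is determined by the directions before time \<open>t\<close>, hence is independent of
  \<open>u t\<close>.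
\<close>

lemma residual_iterate_cong:
  assumes "\<And>s. s < t \<Longrightarrow> w s = w' s"
  shows "residual_iterate f \<alpha> \<eta> x1 w t = residual_iterate f \<alpha> \<eta> x1 w' t"
  using assms by (induction f \<alpha> \<eta> x1 w t rule: residual_iterate.induct) auto

lemma residual_iterate_measurable:
  fixes f :: "'a::euclidean_space \<Rightarrow> real"
  assumes f[measurable]: "f \<in> borel_measurable borel" and "{0..<t} \<subseteq> I"
  shows "(\<lambda>w. residual_iterate f \<alpha> \<eta> x1 w t) \<in> borel_measurable (PiM I (\<lambda>_. borel))"
  using assms(2)
proof (induction t rule: induct_nat_012)
  case (ge2 n)
  have [measurable]: "(\<lambda>w. w n) \<in> borel_measurable (PiM I (\<lambda>_. borel))"
    "(\<lambda>w. w (Suc n)) \<in> borel_measurable (PiM I (\<lambda>_. borel))"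
    using ge2.prems by (auto intro!: measurable_component_singleton)
  have [measurable]: "(\<lambda>w. residual_iterate f \<alpha> \<eta> x1 w n) \<in> borel_measurable (PiM I (\<lambda>_. borel))"
    "(\<lambda>w. residual_iterate f \<alpha> \<eta> x1 w (Suc n)) \<in> borel_measurable (PiM I (\<lambda>_. borel))"
    using ge2.prems by (auto intro!: ge2.IH)
  show ?case
    by (simp add: residual_grad_def)
qed auto

lemma residual_iterate_bounded:
  fixes f :: "'a::euclidean_space \<Rightarrow> real"
  assumes lip: "L0-lipschitz_on UNIV f"
  shows "\<exists>C. \<forall>w. (\<forall>s<t. norm (w s) \<le> 1) \<longrightarrow> norm (residual_iterate f \<alpha> \<eta> x1 w t) \<le> C"
proof (induction t rule: induct_nat_012)
  case (ge2 n)
  obtain C0 where C0: "\<And>w. \<forall>s<n. norm (w s) \<le> 1 \<Longrightarrow> norm (residual_iterate f \<alpha> \<eta> x1 w n) \<le> C0"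
    using ge2.IH(1) by blast
  obtain C1 where C1: "\<And>w. \<forall>s<Suc n. norm (w s) \<le> 1 \<Longrightarrow> norm (residual_iterate f \<alpha> \<eta> x1 w (Suc n)) \<le> C1"
    using ge2.IH(2) by blast
  have L0: "0 \<le> L0" using lip by (rule lipschitz_on_nonneg)
  define B where "B = L0 * (C1 + \<bar>\<alpha>\<bar> + (C0 + \<bar>\<alpha>\<bar>))"
  show ?case
  proof (intro exI allI impI)
    fix w :: "nat \<Rightarrow> 'a" assume w: "\<forall>s<Suc (Suc n). norm (w s) \<le> 1"
    define x where "x = residual_iterate f \<alpha> \<eta> x1 w (Suc n)"
    define x' where "x' = residual_iterate f \<alpha> \<eta> x1 w n"
    have x: "norm x \<le> C1" "norm x' \<le> C0" "norm (w (Suc n)) \<le> 1" "norm (w n) \<le> 1"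
      using w by (auto simp: x_def x'_def intro!: C0 C1)
    have "norm ((x + \<alpha> *\<^sub>R w (Suc n)) - (x' + \<alpha> *\<^sub>R w n)) \<le> norm x + norm (\<alpha> *\<^sub>R w (Suc n)) + (norm x' + norm (\<alpha> *\<^sub>R w n))"
      by (meson add_mono norm_triangle_ineq norm_triangle_ineq4 order_trans)
    also have "\<dots> \<le> C1 + \<bar>\<alpha>\<bar> + (C0 + \<bar>\<alpha>\<bar>)"
      using x by (intro add_mono) (auto simp: mult_left_le)
    finally have "L0 * norm ((x + \<alpha> *\<^sub>R w (Suc n)) - (x' + \<alpha> *\<^sub>R w n)) \<le> B"
      unfolding B_def using L0 by (rule mult_left_mono)
    then have fd: "\<bar>f (x + \<alpha> *\<^sub>R w (Suc n)) - f (x' + \<alpha> *\<^sub>R w n)\<bar> \<le> B"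
      using lipschitz_onD[OF lip, of "x + \<alpha> *\<^sub>R w (Suc n)" "x' + \<alpha> *\<^sub>R w n"] by (simp add: dist_norm)
    then have B: "0 \<le> B" by linarith
    let ?g = "residual_grad f \<alpha> x (w (Suc n)) x' (w n)"
    have "norm ?g = real DIM('a) * (\<bar>f (x + \<alpha> *\<^sub>R w (Suc n)) - f (x' + \<alpha> *\<^sub>R w n)\<bar> / \<bar>\<alpha>\<bar>) * norm (w (Suc n))"
      by (simp add: residual_grad_def abs_mult)
    also have "\<dots> \<le> real DIM('a) * (B / \<bar>\<alpha>\<bar>) * 1"
      using fd x(3) B by (intro mult_mono divide_right_mono mult_nonneg_nonneg divide_nonneg_nonneg) auto
    finally have "\<bar>\<eta>\<bar> * norm ?g \<le> \<bar>\<eta>\<bar> * (real DIM('a) * (B / \<bar>\<alpha>\<bar>) * 1)"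
      by (intro mult_left_mono abs_ge_zero)
    then have "norm (\<eta> *\<^sub>R ?g) \<le> \<bar>\<eta>\<bar> * (real DIM('a) * (B / \<bar>\<alpha>\<bar>))"
      by simp
    moreover have "norm (x - \<eta> *\<^sub>R ?g) \<le> norm x + norm (\<eta> *\<^sub>R ?g)"
      by (rule norm_triangle_ineq4)
    ultimately show "norm (residual_iterate f \<alpha> \<eta> x1 w (Suc (Suc n)))
      \<le> C1 + \<bar>\<eta>\<bar> * (real DIM('a) * (B / \<bar>\<alpha>\<bar>))"
      using x(1) by (simp add: x_def x'_def)
  qed
qed auto

section \<open>Averaging over a fresh direction\<close>

text \<open>
  Independence of the past and the current direction, stated as a product law because
  \<open>indep_var\<close> requires both variables to take values in the same type.
\<close>

lemma (in prob_space) joint_distr_past_fresh: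
  fixes u :: "nat \<Rightarrow> 'a \<Rightarrow> 'b::topological_space" and Z :: "(nat \<Rightarrow> 'b) \<Rightarrow> 'c::topological_space"
  assumes ind: "indep_vars (\<lambda>_. borel) u {0..T}" and t: "t \<le> T"
    and Z[measurable]: "Z \<in> borel_measurable (PiM {0..<t} (\<lambda>_. borel))"
    and dep: "\<And>w w'. (\<And>s. s < t \<Longrightarrow> w s = w' s) \<Longrightarrow> Z w = Z w'"
  shows "distr M (borel \<Otimes>\<^sub>M borel) (\<lambda>\<omega>. (Z (\<lambda>s. u s \<omega>), u t \<omega>))
    = distr M borel (\<lambda>\<omega>. Z (\<lambda>s. u s \<omega>)) \<Otimes>\<^sub>M distr M borel (u t)"
proof -
  let ?N = "PiM {0..<t} (\<lambda>_. borel) :: (nat \<Rightarrow> 'b) measure"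
  let ?N' = "PiM {t} (\<lambda>_. borel) :: (nat \<Rightarrow> 'b) measure"
  define X where "X = (\<lambda>\<omega>. restrict (\<lambda>i. u i \<omega>) {0..<t})"
  define Y where "Y = (\<lambda>\<omega>. restrict (\<lambda>i. u i \<omega>) {t})"
  have "indep_var ?N X ?N' Y"
    unfolding X_def Y_def using t by (intro indep_var_restrict[OF ind]) auto
  then have X[measurable]: "X \<in> measurable M ?N" and Y[measurable]: "Y \<in> measurable M ?N'"
    and joint: "distr M ?N X \<Otimes>\<^sub>M distr M ?N' Y = distr M (?N \<Otimes>\<^sub>M ?N') (\<lambda>\<omega>. (X \<omega>, Y \<omega>))"
    unfolding indep_var_distribution_eq by auto
  have last[measurable]: "(\<lambda>w. w t) \<in> borel_measurable ?N'"
    by (rule measurable_component_singleton) simp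
  have ZX: "Z (X \<omega>) = Z (\<lambda>s. u s \<omega>)" for \<omega>
    by (rule dep) (simp add: X_def)
  have Yt: "Y \<omega> t = u t \<omega>" for \<omega>
    by (simp add: Y_def)
  have dX: "distr (distr M ?N X) borel Z = distr M borel (\<lambda>\<omega>. Z (\<lambda>s. u s \<omega>))"
    by (subst distr_distr) (auto simp: comp_def ZX)
  have dY: "distr (distr M ?N' Y) borel (\<lambda>w. w t) = distr M borel (u t)"
    by (subst distr_distr) (auto simp: comp_def Yt)
  have "distr M borel (\<lambda>\<omega>. Z (\<lambda>s. u s \<omega>)) \<Otimes>\<^sub>M distr M borel (u t)
    = distr (distr M ?N X \<Otimes>\<^sub>M distr M ?N' Y) (borel \<Otimes>\<^sub>M borel) (\<lambda>(x, y). (Z x, y t))"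
    unfolding dX[symmetric] dY[symmetric]
  proof (rule pair_measure_distr)
    show "sigma_finite_measure (distr (distr M ?N' Y) borel (\<lambda>w. w t))"
      by (intro prob_space_imp_sigma_finite prob_space.prob_space_distr prob_space_distr) measurable
  qed auto
  also have "\<dots> = distr M (borel \<Otimes>\<^sub>M borel) (\<lambda>\<omega>. (Z (\<lambda>s. u s \<omega>), u t \<omega>))"
    unfolding joint by (subst distr_distr) (auto simp: comp_def ZX Yt)
  finally show "distr M (borel \<Otimes>\<^sub>M borel) (\<lambda>\<omega>. (Z (\<lambda>s. u s \<omega>), u t \<omega>))
    = distr M borel (\<lambda>\<omega>. Z (\<lambda>s. u s \<omega>)) \<Otimes>\<^sub>M distr M borel (u t)" ..
qed

lemma (in prob_space) expectation_product_law:
  fixes H :: "'b \<times> 'c \<Rightarrow> real"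
  assumes X[measurable]: "X \<in> measurable M N" and Y[measurable]: "Y \<in> measurable M Q"
    and Q: "prob_space Q"
    and joint: "distr M (N \<Otimes>\<^sub>M Q) (\<lambda>\<omega>. (X \<omega>, Y \<omega>)) = distr M N X \<Otimes>\<^sub>M Q"
    and H[measurable]: "H \<in> borel_measurable (N \<Otimes>\<^sub>M Q)"
    and int: "integrable M (\<lambda>\<omega>. H (X \<omega>, Y \<omega>))"
  shows "integrable M (\<lambda>\<omega>. \<integral>y. H (X \<omega>, y) \<partial>Q)"
    and "expectation (\<lambda>\<omega>. H (X \<omega>, Y \<omega>)) = expectation (\<lambda>\<omega>. \<integral>y. H (X \<omega>, y) \<partial>Q)"
proof -
  interpret PX: prob_space "distr M N X"
    by (rule prob_space_distr) measurable
  interpret Q: prob_space Q by fact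
  interpret P: pair_sigma_finite "distr M N X" Q ..
  have int_H: "integrable (distr M N X \<Otimes>\<^sub>M Q) H"
    unfolding joint[symmetric] by (subst integrable_distr_eq) (use int in auto)
  show "integrable M (\<lambda>\<omega>. \<integral>y. H (X \<omega>, y) \<partial>Q)"
    using P.integrable_fst'[OF int_H] by (subst (asm) integrable_distr_eq) auto
  have "expectation (\<lambda>\<omega>. H (X \<omega>, Y \<omega>)) = integral\<^sup>L (distr M N X \<Otimes>\<^sub>M Q) H"
    unfolding joint[symmetric] by (subst integral_distr) auto
  also have "\<dots> = (\<integral>x. (\<integral>y. H (x, y) \<partial>Q) \<partial>distr M N X)"
    using P.integral_fst'[OF int_H] by simp
  also have "\<dots> = expectation (\<lambda>\<omega>. \<integral>y. H (X \<omega>, y) \<partial>Q)"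
    by (subst integral_distr) auto
  finally show "expectation (\<lambda>\<omega>. H (X \<omega>, Y \<omega>)) = expectation (\<lambda>\<omega>. \<integral>y. H (X \<omega>, y) \<partial>Q)" .
qed

text \<open>
  Conditioning on the past without conditional expectations: the current direction may be
  integrated out over the sphere while the past is held fixed.
\<close>

lemma (in prob_space) expectation_fresh_direction:
  fixes u :: "nat \<Rightarrow> 'a \<Rightarrow> 'b::euclidean_space" and Z :: "(nat \<Rightarrow> 'b) \<Rightarrow> 'c::euclidean_space"
    and H :: "'c \<times> 'b \<Rightarrow> real"
  assumes ind: "indep_vars (\<lambda>_. borel) u {0..T}" and t: "t \<le> T"
    and unif: "distr M borel (u t) = uniform_sphere"
    and Z: "Z \<in> borel_measurable (PiM {0..<t} (\<lambda>_. borel))"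
    and dep: "\<And>w w'. (\<And>s. s < t \<Longrightarrow> w s = w' s) \<Longrightarrow> Z w = Z w'"
    and Z_meas: "(\<lambda>\<omega>. Z (\<lambda>s. u s \<omega>)) \<in> borel_measurable M"
    and H: "continuous_on UNIV H"
    and int: "integrable M (\<lambda>\<omega>. H (Z (\<lambda>s. u s \<omega>), u t \<omega>))"
  shows "integrable M (\<lambda>\<omega>. \<integral>v. H (Z (\<lambda>s. u s \<omega>), v) \<partial>uniform_sphere)"
    and "expectation (\<lambda>\<omega>. H (Z (\<lambda>s. u s \<omega>), u t \<omega>))
      = expectation (\<lambda>\<omega>. \<integral>v. H (Z (\<lambda>s. u s \<omega>), v) \<partial>uniform_sphere)"
proof -
  have ut: "u t \<in> measurable M uniform_sphere"
    using ind t unfolding indep_vars_def measurable_cong_sets[OF refl sets_uniform_sphere] by auto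
  have sets_eq: "sets (borel \<Otimes>\<^sub>M uniform_sphere) = sets (borel \<Otimes>\<^sub>M (borel :: 'b measure))"
    by (rule sets_pair_measure_cong) auto
  have Hm: "H \<in> borel_measurable (borel \<Otimes>\<^sub>M uniform_sphere)"
    using H unfolding measurable_cong_sets[OF sets_eq refl] borel_prod
    by (rule borel_measurable_continuous_onI)
  have joint: "distr M (borel \<Otimes>\<^sub>M uniform_sphere) (\<lambda>\<omega>. (Z (\<lambda>s. u s \<omega>), u t \<omega>))
    = distr M borel (\<lambda>\<omega>. Z (\<lambda>s. u s \<omega>)) \<Otimes>\<^sub>M uniform_sphere"
    using joint_distr_past_fresh[OF ind t Z dep]
    unfolding unif distr_cong[OF refl sets_eq refl] by simp
  from expectation_product_law[OF Z_meas ut prob_space_uniform_sphere joint Hm int]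
  show "integrable M (\<lambda>\<omega>. \<integral>v. H (Z (\<lambda>s. u s \<omega>), v) \<partial>uniform_sphere)"
    and "expectation (\<lambda>\<omega>. H (Z (\<lambda>s. u s \<omega>), u t \<omega>))
      = expectation (\<lambda>\<omega>. \<integral>v. H (Z (\<lambda>s. u s \<omega>), v) \<partial>uniform_sphere)"
    by auto
qed

section \<open>Summing the two recursions\<close>

text \<open>
  Summing the noise recursion solves it up to the factor \<open>4 / 3\<close> and bounds \<open>\<Sum> D t\<close> by
  \<open>16 \<eta>\<^sup>2 d \<Sum> n t\<close> plus the smoothing noise.  The gradient norms are absorbed through
  \<open>n t \<le> 2 L (\<delta> t - c) + 2 L c\<close> with \<open>c = L \<alpha>\<^sup>2 / 2\<close>, so that it is the sum \<open>S\<close> of the excesses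
  \<open>\<delta> t - c\<close> which is multiplied by a constant and divided back; bounding the \<open>\<delta> t\<close> themselves would
  inflate the final term \<open>c\<close>.  The excesses may be negative, which is harmless: if \<open>S \<le> 0\<close> the claim
  is immediate.
\<close>

lemma averaged_descent_bound:
  fixes R D n \<delta> :: "nat \<Rightarrow> real" and \<eta> d L \<alpha> :: real
  assumes \<eta>: "\<eta> > 0" "64 * d * L * \<eta> \<le> 1" and d: "d \<ge> 1" and L: "L > 0" and T: "T \<ge> 1"
    and R: "\<And>t. 0 \<le> R t"
    and R_step: "\<And>t. 1 \<le> t \<Longrightarrow> t \<le> T \<Longrightarrow> R (Suc t) \<le> R t - 2 * \<eta> * (\<delta> t - L * \<alpha>\<^sup>2 / 2) + D t"
    and D: "D 0 = 0" "\<And>t. 0 \<le> D t"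
    and D_step: "\<And>t. 1 \<le> t \<Longrightarrow> t \<le> T \<Longrightarrow>
      D t \<le> 4 * \<eta>\<^sup>2 * d * (n t + n (t - 1)) + D (t - 1) / 4 + 4 * \<eta>\<^sup>2 * d\<^sup>2 * L\<^sup>2 * \<alpha>\<^sup>2"
    and n0: "n 0 = n 1" and n: "\<And>t. 0 \<le> n t" "\<And>t. 1 \<le> t \<Longrightarrow> t \<le> T \<Longrightarrow> n t \<le> 2 * L * \<delta> t"
  shows "(\<Sum>t=1..T. \<delta> t) / T \<le> R 1 / (\<eta> * T) + 20 * \<eta> * d\<^sup>2 * L\<^sup>2 * \<alpha>\<^sup>2 + L * \<alpha>\<^sup>2 / 2"
proof -
  define c where "c = L * \<alpha>\<^sup>2 / 2"
  define S where "S = (\<Sum>t=1..T. \<delta> t - c)"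
  define SD where "SD = (\<Sum>t=1..T. D t)"
  define Sn where "Sn = (\<Sum>t=1..T. n t)"
  have c: "0 \<le> c" using L by (simp add: c_def)
  have shift: "(\<Sum>t=1..T. h (t - 1)) \<le> h 0 + (\<Sum>t=1..T. h t)" if "\<And>t. 0 \<le> h t" for h :: "nat \<Rightarrow> real"
  proof -
    have "(\<Sum>t=1..T. h (t - 1)) = (\<Sum>t<T. h t)"
      by (rule sum.reindex_bij_witness[where i = Suc and j = "\<lambda>t. t - 1"]) auto
    also have "\<dots> \<le> (\<Sum>t\<in>insert 0 {1..T}. h t)"
      using that by (intro sum_mono2) auto
    finally show ?thesis by simp
  qed
  have tele: "2 * \<eta> * S \<le> R 1 + SD"
  proof -
    have "(\<Sum>t=1..T. R (Suc t) - R t) = R (Suc T) - R 1"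
      using T by (subst sum_Suc_diff) auto
    moreover have "(\<Sum>t=1..T. R (Suc t) - R t) \<le> (\<Sum>t=1..T. D t - 2 * \<eta> * (\<delta> t - c))"
      using R_step by (intro sum_mono) (auto simp: c_def algebra_simps)
    moreover have "(\<Sum>t=1..T. D t - 2 * \<eta> * (\<delta> t - c)) = SD - 2 * \<eta> * S"
      by (simp add: SD_def S_def sum_subtractf flip: sum_distrib_left)
    ultimately show ?thesis using R[of "Suc T"] by linarith
  qed
  have SD_le: "SD \<le> 16 * \<eta>\<^sup>2 * d * Sn + 16 / 3 * T * (\<eta>\<^sup>2 * d\<^sup>2 * L\<^sup>2 * \<alpha>\<^sup>2)"
  proof -
    have "SD \<le> (\<Sum>t=1..T. 4 * \<eta>\<^sup>2 * d * (n t + n (t - 1)) + D (t - 1) / 4 + 4 * \<eta>\<^sup>2 * d\<^sup>2 * L\<^sup>2 * \<alpha>\<^sup>2)"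
      unfolding SD_def using D_step by (intro sum_mono) auto
    also have "\<dots> = 4 * \<eta>\<^sup>2 * d * (Sn + (\<Sum>t=1..T. n (t - 1))) + (\<Sum>t=1..T. D (t - 1)) / 4
        + T * (4 * \<eta>\<^sup>2 * d\<^sup>2 * L\<^sup>2 * \<alpha>\<^sup>2)"
      by (simp add: Sn_def sum.distrib sum_divide_distrib flip: sum_distrib_left)
    finally have "SD \<le> 4 * \<eta>\<^sup>2 * d * (Sn + (\<Sum>t=1..T. n (t - 1))) + (\<Sum>t=1..T. D (t - 1)) / 4
        + T * (4 * \<eta>\<^sup>2 * d\<^sup>2 * L\<^sup>2 * \<alpha>\<^sup>2)" .
    moreover have "(\<Sum>t=1..T. D (t - 1)) \<le> SD"
      using shift[of D] D by (simp add: SD_def)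
    moreover have "4 * \<eta>\<^sup>2 * d * (Sn + (\<Sum>t=1..T. n (t - 1))) \<le> 4 * \<eta>\<^sup>2 * d * (Sn + 2 * Sn)"
    proof (intro mult_left_mono add_left_mono)
      \<comment> \<open>The shifted sum starts with \<open>n 0 = n 1\<close>, a summand of \<open>Sn\<close>; doubling \<open>Sn\<close> covers it.\<close>
      have "n 0 \<le> Sn"
        unfolding Sn_def n0 using T n(1) by (intro member_le_sum) auto
      with shift[of n] n(1) show "(\<Sum>t=1..T. n (t - 1)) \<le> 2 * Sn" by (simp add: Sn_def)
    qed (use d in auto)
    ultimately have "SD \<le> 4 * \<eta>\<^sup>2 * d * (Sn + 2 * Sn) + SD / 4 + T * (4 * \<eta>\<^sup>2 * d\<^sup>2 * L\<^sup>2 * \<alpha>\<^sup>2)"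
      by linarith
    then show ?thesis by (simp add: algebra_simps)
  qed
  have "Sn \<le> (\<Sum>t=1..T. 2 * L * (\<delta> t - c) + 2 * L * c)"
    unfolding Sn_def
  proof (rule sum_mono)
    fix t assume "t \<in> {1..T}"
    then have "n t \<le> 2 * L * \<delta> t"
      by (intro n(2)) auto
    then show "n t \<le> 2 * L * (\<delta> t - c) + 2 * L * c"
      by (simp add: right_diff_distrib)
  qed
  also have "\<dots> = 2 * L * S + T * (2 * L * c)"
    by (simp add: S_def sum.distrib flip: sum_distrib_left)
  finally have Sn_le: "16 * \<eta>\<^sup>2 * d * Sn \<le> 16 * \<eta>\<^sup>2 * d * (2 * L * S + T * (2 * L * c))"
    using d by (intro mult_left_mono) auto
  have "S / T \<le> R 1 / (\<eta> * T) + 20 * \<eta> * d\<^sup>2 * L\<^sup>2 * \<alpha>\<^sup>2"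
  proof (cases "S \<le> 0")
    case True
    then have "S / T \<le> 0"
      by (simp add: divide_nonpos_nonneg)
    also have "0 \<le> R 1 / (\<eta> * T) + 20 * \<eta> * d\<^sup>2 * L\<^sup>2 * \<alpha>\<^sup>2"
      using R[of 1] \<eta> by simp
    finally show ?thesis .
  next
    case False
    define E where "E = \<eta> * (T * (\<eta> * d\<^sup>2 * L\<^sup>2 * \<alpha>\<^sup>2))"
    have E: "0 \<le> E" using \<eta> by (simp add: E_def)
    have "16 * \<eta>\<^sup>2 * d * (2 * L * S) = (64 * d * L * \<eta>) * (\<eta> * S) / 2"
      by (simp add: power2_eq_square)
    also have "\<dots> \<le> 1 * (\<eta> * S) / 2"
      using \<eta> False by (intro divide_right_mono mult_right_mono) auto
    also have "\<dots> = \<eta> * S / 2"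
      by simp
    finally have A: "16 * \<eta>\<^sup>2 * d * (2 * L * S) \<le> \<eta> * S / 2" .
    have "16 * \<eta>\<^sup>2 * d * (T * (2 * L * c)) = 16 * (d * (\<eta> * (T * (\<eta> * L\<^sup>2 * \<alpha>\<^sup>2))))"
      by (simp add: power2_eq_square c_def)
    also have "\<dots> \<le> 16 * (d\<^sup>2 * (\<eta> * (T * (\<eta> * L\<^sup>2 * \<alpha>\<^sup>2))))"
      using d \<eta> by (intro mult_left_mono mult_right_mono) (auto simp: power2_eq_square)
    also have "\<dots> = 16 * E"
      by (simp add: E_def)
    finally have B: "16 * \<eta>\<^sup>2 * d * (T * (2 * L * c)) \<le> 16 * E" .
    have C: "16 / 3 * T * (\<eta>\<^sup>2 * d\<^sup>2 * L\<^sup>2 * \<alpha>\<^sup>2) = 16 / 3 * E"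
      by (simp add: E_def power2_eq_square)
    have "2 * \<eta> * S \<le> R 1 + \<eta> * S / 2 + 16 * E + 16 / 3 * E"
      using tele SD_le Sn_le[unfolded distrib_left] A B C by linarith
    \<comment> \<open>\<open>3/2 \<eta> S \<le> R 1 + 64/3 E\<close>, with room to spare in the constant 20.\<close>
    then have "\<eta> * S \<le> R 1 + 20 * E"
      using R[of 1] E by simp
    then have "\<eta> * S / (\<eta> * T) \<le> (R 1 + 20 * E) / (\<eta> * T)"
      using \<eta> by (intro divide_right_mono) auto
    then show ?thesis
      using \<eta> T by (simp add: E_def add_divide_distrib)
  qed
  moreover have "S / T = (\<Sum>t=1..T. \<delta> t) / T - c"
    using T by (simp add: S_def sum_subtractf field_simps)
  ultimately show ?thesis
    by (simp add: c_def)
qed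

section \<open>The convergence bound\<close>

theorem theorem1:
  fixes f :: "'a::euclidean_space \<Rightarrow> real"
    and L0 L \<alpha> \<eta> :: real and x1 xstar :: 'a and T :: nat
    and M :: "'w measure" and u :: "nat \<Rightarrow> 'w \<Rightarrow> 'a"
  assumes "L0 > 0" and "L0-lipschitz_on UNIV f"
    and "L > 0" and "L_smooth L f"
    and "convex_on UNIV f"
    and "\<forall>x. f xstar \<le> f x"
    and "\<alpha> > 0"
    and "\<eta> = min (\<alpha> / (4 * real DIM('a) * L0)) (1 / (64 * real DIM('a) * L))"
    and "T \<ge> 1"
    and "prob_space M"
    and "prob_space.indep_vars M (\<lambda>_. borel) u {0..T}"
    and "\<forall>t\<in>{0..T}. distr M borel (u t) = uniform_sphere"
  shows "(1 / real T) * (\<Sum>t=1..T. prob_space.expectation M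
             (\<lambda>\<omega>. f (residual_iterate f \<alpha> \<eta> x1 (\<lambda>s. u s \<omega>) t) - f xstar))
         \<le> (norm (x1 - xstar))\<^sup>2 / (\<eta> * real T)
           + 20 * \<eta> * (real DIM('a))\<^sup>2 * L\<^sup>2 * \<alpha>\<^sup>2
           + 16 * \<eta> * real DIM('a) * L0\<^sup>2 / real T
           + L * \<alpha>\<^sup>2 / 2"
proof -
  note L0 = assms(1) and lip = assms(2) and L = assms(3) and conv = assms(5) and min = assms(6)
    and \<alpha> = assms(7) and \<eta>_def = assms(8) and T = assms(9) and ind = assms(11) and unif = assms(12)
  interpret prob_space M by fact
  let ?d = "real DIM('a)"
  have d: "?d \<ge> 1"
    using DIM_positive[where 'a = 'a] by linarith
  have \<eta>: "\<eta> > 0" "\<eta> \<le> \<alpha> / (4 * ?d * L0)" "\<eta> \<le> 1 / (64 * ?d * L)"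
    using \<alpha> L0 L d by (auto simp: \<eta>_def)
  have \<eta>L: "64 * ?d * L * \<eta> \<le> 1"
    using \<eta>(3) L d by (simp add: field_simps)
  have \<eta>L0: "\<eta> * ?d * L0 / \<alpha> \<le> 1 / 4"
    using \<eta>(2) L0 \<alpha> d by (simp add: field_simps)
  obtain g where grad: "\<And>x. GDERIV f x :> g x" and glip: "\<And>x y. norm (g x - g y) \<le> L * norm (x - y)"
    using assms(4) unfolding L_smooth_def by blast
  have g_sq: "(norm (g x))\<^sup>2 \<le> 2 * L * (f x - f xstar)" for x
    using min by (intro smooth_gradient_norm_le[OF L grad glip]) auto
  have "g xstar = 0"
    using g_sq[of xstar] by simp
  then have upper: "f (xstar + \<alpha> *\<^sub>R v) \<le> f xstar + L * \<alpha>\<^sup>2 / 2" if "norm v \<le> 1" for v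
  proof -
    have "f (xstar + \<alpha> *\<^sub>R v) \<le> f xstar + L / 2 * (norm (\<alpha> *\<^sub>R v))\<^sup>2"
      using smooth_upper_bound[OF grad glip, of xstar "\<alpha> *\<^sub>R v"] \<open>g xstar = 0\<close> by simp
    also have "(norm (\<alpha> *\<^sub>R v))\<^sup>2 \<le> \<alpha>\<^sup>2"
      using that \<alpha> by (intro power_mono) (auto simp: mult_left_le)
    finally show ?thesis
      using L by (simp add: mult_left_mono)
  qed
  have f_cont: "continuous_on UNIV f"
    using lip by (rule lipschitz_on_continuous_on)
  have f_meas [measurable]: "f \<in> borel_measurable borel"
    using f_cont by (rule borel_measurable_continuous_onI)
  have "L-lipschitz_on UNIV g"
    using glip L by (intro lipschitz_onI) (auto simp: dist_norm)
  then have g_cont: "continuous_on UNIV g"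
    by (rule lipschitz_on_continuous_on)
  have f_comp: "continuous_on S (\<lambda>z. f (h z))" and g_comp: "continuous_on S (\<lambda>z. g (h z))"
    if "continuous_on S h" for S and h :: "'z::topological_space \<Rightarrow> 'a"
    using continuous_on_compose2[OF f_cont that] continuous_on_compose2[OF g_cont that] by auto
  note cont = continuous_intros f_comp g_comp

  define X where "X = (\<lambda>t \<omega>. residual_iterate f \<alpha> \<eta> x1 (\<lambda>s. u s \<omega>) t)"
  have X1: "X 0 \<omega> = x1" "X (Suc 0) \<omega> = x1" for \<omega>
    by (simp_all add: X_def)
  have X_step: "X (Suc (Suc t)) \<omega> = X (Suc t) \<omega>
      - \<eta> *\<^sub>R residual_grad f \<alpha> (X (Suc t) \<omega>) (u (Suc t) \<omega>) (X t \<omega>) (u t \<omega>)" for t \<omega>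
    by (simp add: X_def)
  have u_meas [measurable]: "u t \<in> borel_measurable M" if "t \<le> T" for t
    using ind that unfolding indep_vars_def by auto
  have X_meas [measurable]: "X t \<in> borel_measurable M" if t: "t \<le> Suc T" for t
  proof -
    have "(\<lambda>\<omega>. residual_iterate f \<alpha> \<eta> x1 (restrict (\<lambda>s. u s \<omega>) {0..<Suc T}) t) \<in> borel_measurable M"
      by (rule measurable_compose[OF measurable_restrict residual_iterate_measurable[OF f_meas]])
        (use t u_meas in auto)
    also have "(\<lambda>\<omega>. residual_iterate f \<alpha> \<eta> x1 (restrict (\<lambda>s. u s \<omega>) {0..<Suc T}) t) = X t"
      unfolding X_def using t by (intro ext residual_iterate_cong) auto
    finally show ?thesis .
  qed
  have u_norm: "AE \<omega> in M. \<forall>t\<in>{0..T}. norm (u t \<omega>) = 1"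
  proof (rule AE_finite_allI)
    fix t assume t: "t \<in> {0..T}"
    then have unif_t: "distr M borel (u t) = uniform_sphere"
      using unif by blast
    have "AE v in distr M borel (u t). norm v = 1"
      unfolding unif_t by (rule AE_uniform_sphere)
    then show "AE \<omega> in M. norm (u t \<omega>) = 1"
      using t by (subst (asm) AE_distr_iff) auto
  qed simp
  obtain C where C: "AE \<omega> in M. \<forall>t\<le>Suc T. norm (X t \<omega>) \<le> C"
  proof -
    have "\<forall>t. \<exists>c. \<forall>w. (\<forall>s<t. norm (w s) \<le> 1) \<longrightarrow> norm (residual_iterate f \<alpha> \<eta> x1 w t) \<le> c"
      using residual_iterate_bounded[OF lip] by blast
    from choice[OF this] obtain Cf where Cf: "\<And>t w. \<forall>s<t. norm (w s) \<le> 1 \<Longrightarrow> norm (residual_iterate f \<alpha> \<eta> x1 w t) \<le> Cf t"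
      by blast
    have "AE \<omega> in M. \<forall>t\<le>Suc T. norm (X t \<omega>) \<le> Max (Cf ` {..Suc T})"
      using u_norm
    proof eventually_elim
      case (elim \<omega>)
      show ?case
      proof (intro allI impI)
        fix t assume t: "t \<le> Suc T"
        have "norm (X t \<omega>) \<le> Cf t"
          unfolding X_def using elim t by (intro Cf) auto
        also have "\<dots> \<le> Max (Cf ` {..Suc T})"
          using t by (intro Max_ge) auto
        finally show "norm (X t \<omega>) \<le> Max (Cf ` {..Suc T})" .
      qed
    qed
    then show thesis by (rule that)
  qed
  \<comment> \<open>Bounded continuous functions of two iterates and two directions cover all integrability needed below.\<close>
  have int: "integrable M (\<lambda>\<omega>. H (X t \<omega>, X t' \<omega>, u s \<omega>, u s' \<omega>))"
    if ts: "t \<le> Suc T" "t' \<le> Suc T" "s \<le> T" "s' \<le> T" and H: "continuous_on UNIV H"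
    for t t' s s' and H :: "'a \<times> 'a \<times> 'a \<times> 'a \<Rightarrow> real"
  proof (rule integrable_continuous_of_AE_bounded[where C = "C + (C + (1 + 1))" and H = H
        and Z = "\<lambda>\<omega>. (X t \<omega>, X t' \<omega>, u s \<omega>, u s' \<omega>)"])
    show "finite_measure M" by (rule finite_measure_axioms)
    note [measurable] = X_meas[OF ts(1)] X_meas[OF ts(2)] u_meas[OF ts(3)] u_meas[OF ts(4)]
    show "(\<lambda>\<omega>. (X t \<omega>, X t' \<omega>, u s \<omega>, u s' \<omega>)) \<in> borel_measurable M"
      by (intro borel_measurable_Pair) measurable
    show "AE \<omega> in M. norm (X t \<omega>, X t' \<omega>, u s \<omega>, u s' \<omega>) \<le> C + (C + (1 + 1))"
      using u_norm C
    proof eventually_elim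
      case (elim \<omega>)
      have "norm (X t \<omega>, X t' \<omega>, u s \<omega>, u s' \<omega>)
        \<le> norm (X t \<omega>) + (norm (X t' \<omega>) + (norm (u s \<omega>) + norm (u s' \<omega>)))"
        by (intro order_trans[OF norm_Pair_le] add_left_mono order_refl)
      also have "\<dots> \<le> C + (C + (1 + 1))"
        using elim ts by (intro add_mono) auto
      finally show ?case .
    qed
  qed (rule H)
  have past_meas: "(\<lambda>w. residual_iterate f \<alpha> \<eta> x1 w s) \<in> borel_measurable (PiM {0..<t} (\<lambda>_. borel))"
    if "s \<le> t" for s t
    using that by (intro residual_iterate_measurable f_meas) auto

  define R where "R = (\<lambda>t. expectation (\<lambda>\<omega>. (norm (X t \<omega> - xstar))\<^sup>2))"
  define D where "D = (\<lambda>t. expectation (\<lambda>\<omega>. (norm (X (Suc t) \<omega> - X t \<omega>))\<^sup>2))"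
  define n where "n = (\<lambda>t. expectation (\<lambda>\<omega>. (norm (g (X t \<omega>)))\<^sup>2))"
  define \<delta> where "\<delta> = (\<lambda>t. expectation (\<lambda>\<omega>. f (X t \<omega>) - f xstar))"

  have int_f: "integrable M (\<lambda>\<omega>. f (X t \<omega>) - f xstar)" if "t \<le> T" for t
  proof -
    have "continuous_on UNIV (\<lambda>z::'a \<times> 'a \<times> 'a \<times> 'a. f (fst z) - f xstar)"
      by (intro cont)
    from int[OF _ _ _ _ this, of t t t t] that show ?thesis by simp
  qed
  have int_g: "integrable M (\<lambda>\<omega>. (norm (g (X t \<omega>)))\<^sup>2)" if "t \<le> T" for t
  proof -
    have "continuous_on UNIV (\<lambda>z::'a \<times> 'a \<times> 'a \<times> 'a. (norm (g (fst z)))\<^sup>2)"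
      by (intro cont)
    from int[OF _ _ _ _ this, of t t t t] that show ?thesis by simp
  qed
  have int_R: "integrable M (\<lambda>\<omega>. (norm (X t \<omega> - xstar))\<^sup>2)" if "t \<le> Suc T" for t
  proof -
    have "continuous_on UNIV (\<lambda>z::'a \<times> 'a \<times> 'a \<times> 'a. (norm (fst z - xstar))\<^sup>2)"
      by (intro cont)
    from int[OF _ _ _ _ this, of t t 0 0] that show ?thesis by simp
  qed
  have int_D: "integrable M (\<lambda>\<omega>. (norm (X (Suc t) \<omega> - X t \<omega>))\<^sup>2)" if "t \<le> T" for t
  proof -
    have "continuous_on UNIV (\<lambda>z::'a \<times> 'a \<times> 'a \<times> 'a. (norm (fst z - fst (snd z)))\<^sup>2)"
      by (intro cont)
    from int[OF _ _ _ _ this, of "Suc t" t 0 0] that show ?thesis by simp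
  qed
  have int_ug: "integrable M (\<lambda>\<omega>. (u t \<omega> \<bullet> g (X t \<omega>))\<^sup>2)" if "t \<le> T" for t
  proof -
    have "continuous_on UNIV (\<lambda>z::'a \<times> 'a \<times> 'a \<times> 'a. (fst (snd (snd z)) \<bullet> g (fst z))\<^sup>2)"
      by (intro cont)
    from int[OF _ _ _ _ this, of t t t t] that show ?thesis by simp
  qed

  have second_moment: "expectation (\<lambda>\<omega>. (u t \<omega> \<bullet> g (X t \<omega>))\<^sup>2) = n t / ?d" if t: "t \<le> T" for t
  proof -
    define Z where "Z = (\<lambda>w. residual_iterate f \<alpha> \<eta> x1 w t)"
    define H where "H = (\<lambda>z :: 'a \<times> 'a. (snd z \<bullet> g (fst z))\<^sup>2)"
    have ZX: "Z (\<lambda>s. u s \<omega>) = X t \<omega>" for \<omega>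
      by (simp add: Z_def X_def)
    have "expectation (\<lambda>\<omega>. H (Z (\<lambda>s. u s \<omega>), u t \<omega>))
      = expectation (\<lambda>\<omega>. \<integral>v. H (Z (\<lambda>s. u s \<omega>), v) \<partial>uniform_sphere)"
    proof (rule expectation_fresh_direction(2)[OF ind t])
      show "distr M borel (u t) = uniform_sphere"
        using unif t by simp
      show "Z \<in> borel_measurable (PiM {0..<t} (\<lambda>_. borel))"
        unfolding Z_def by (rule past_meas) simp
      show "Z w = Z w'" if "\<And>s. s < t \<Longrightarrow> w s = w' s" for w w'
        using that unfolding Z_def by (rule residual_iterate_cong)
      show "(\<lambda>\<omega>. Z (\<lambda>s. u s \<omega>)) \<in> borel_measurable M"
        unfolding ZX using t by (intro X_meas) simp
      show "continuous_on UNIV H"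
        unfolding H_def by (intro cont)
      show "integrable M (\<lambda>\<omega>. H (Z (\<lambda>s. u s \<omega>), u t \<omega>))"
        using int_ug[OF t] by (simp add: H_def ZX)
    qed
    then have "expectation (\<lambda>\<omega>. (u t \<omega> \<bullet> g (X t \<omega>))\<^sup>2)
      = expectation (\<lambda>\<omega>. \<integral>v. (v \<bullet> g (X t \<omega>))\<^sup>2 \<partial>uniform_sphere)"
      by (simp add: H_def ZX)
    also have "\<dots> = n t / ?d"
      by (simp add: n_def integral_uniform_sphere_inner_square)
    finally show ?thesis .
  qed

  have descent: "R (Suc (Suc t)) \<le> R (Suc t) - 2 * \<eta> * (\<delta> (Suc t) - L * \<alpha>\<^sup>2 / 2) + D (Suc t)" if t: "Suc t \<le> T" for t
  proof -
    define G where "G = (\<lambda>\<omega>. residual_grad f \<alpha> (X (Suc t) \<omega>) (u (Suc t) \<omega>) (X t \<omega>) (u t \<omega>) \<bullet> (X (Suc t) \<omega> - xstar))"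
    define Z where "Z = (\<lambda>w. (residual_iterate f \<alpha> \<eta> x1 w (Suc t), residual_iterate f \<alpha> \<eta> x1 w t, w t))"
    define H where "H = (\<lambda>z :: ('a \<times> 'a \<times> 'a) \<times> 'a.
      residual_grad f \<alpha> (fst (fst z)) (snd z) (fst (snd (fst z))) (snd (snd (fst z))) \<bullet> (fst (fst z) - xstar))"
    have ZX: "Z (\<lambda>s. u s \<omega>) = (X (Suc t) \<omega>, X t \<omega>, u t \<omega>)" for \<omega>
      by (simp add: Z_def X_def)
    have G_H: "G \<omega> = H (Z (\<lambda>s. u s \<omega>), u (Suc t) \<omega>)" for \<omega>
      by (simp add: G_def H_def ZX)
    have int_G: "integrable M G"
    proof -
      have "continuous_on UNIV (\<lambda>z::'a \<times> 'a \<times> 'a \<times> 'a.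
          residual_grad f \<alpha> (fst z) (fst (snd (snd z))) (fst (snd z)) (snd (snd (snd z))) \<bullet> (fst z - xstar))"
        unfolding residual_grad_def by (intro cont) (use \<alpha> in auto)
      from int[OF _ _ _ _ this, of "Suc t" t "Suc t" t] t show ?thesis
        by (simp add: G_def)
    qed
    have Z_meas: "Z \<in> borel_measurable (PiM {0..<Suc t} (\<lambda>_. borel))"
      unfolding Z_def
      by (intro borel_measurable_Pair past_meas measurable_component_singleton) auto
    have H_cont: "continuous_on UNIV H"
      unfolding H_def residual_grad_def by (intro cont) (use \<alpha> in auto)
    have Z_dep: "Z w = Z w'" if "\<And>s. s < Suc t \<Longrightarrow> w s = w' s" for w w'
      using that by (auto simp: Z_def intro!: residual_iterate_cong)
    have ZX_meas: "(\<lambda>\<omega>. Z (\<lambda>s. u s \<omega>)) \<in> borel_measurable M"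
      unfolding ZX using t by (intro borel_measurable_Pair X_meas u_meas) auto
    have unif_t: "distr M borel (u (Suc t)) = uniform_sphere"
      using unif t by auto
    note fresh = expectation_fresh_direction[OF ind t unif_t Z_meas Z_dep ZX_meas H_cont int_G[unfolded G_H]]
    have "\<delta> (Suc t) - L * \<alpha>\<^sup>2 / 2 = expectation (\<lambda>\<omega>. f (X (Suc t) \<omega>) - f xstar - L * \<alpha>\<^sup>2 / 2)"
      unfolding \<delta>_def using int_f[OF t] by (simp add: prob_space)
    also have "\<dots> \<le> expectation (\<lambda>\<omega>. \<integral>v. H (Z (\<lambda>s. u s \<omega>), v) \<partial>uniform_sphere)"
    proof (rule integral_mono)
      show "integrable M (\<lambda>\<omega>. f (X (Suc t) \<omega>) - f xstar - L * \<alpha>\<^sup>2 / 2)"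
        using int_f[OF t] by simp
      show "integrable M (\<lambda>\<omega>. \<integral>v. H (Z (\<lambda>s. u s \<omega>), v) \<partial>uniform_sphere)"
        by (rule fresh(1))
      show "f (X (Suc t) \<omega>) - f xstar - L * \<alpha>\<^sup>2 / 2 \<le> (\<integral>v. H (Z (\<lambda>s. u s \<omega>), v) \<partial>uniform_sphere)" for \<omega>
        using expectation_residual_grad_inner_ge[OF conv lip \<alpha> upper, of "X (Suc t) \<omega>" "X t \<omega>" "u t \<omega>"]
        by (simp add: H_def ZX)
    qed
    also have "\<dots> = expectation G"
      unfolding G_H by (rule fresh(2)[symmetric])
    finally have G_ge: "\<delta> (Suc t) - L * \<alpha>\<^sup>2 / 2 \<le> expectation G" .
    have expand: "(norm (X (Suc (Suc t)) \<omega> - xstar))\<^sup>2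
        = (norm (X (Suc t) \<omega> - xstar))\<^sup>2 - 2 * \<eta> * G \<omega> + (norm (X (Suc (Suc t)) \<omega> - X (Suc t) \<omega>))\<^sup>2" for \<omega>
      unfolding X_step G_def norm_gradient_step by simp
    have "R (Suc (Suc t)) = R (Suc t) - 2 * \<eta> * expectation G + D (Suc t)"
      unfolding R_def D_def expand using int_R[of "Suc t"] int_D[OF t] int_G t by simp
    also have "\<dots> \<le> R (Suc t) - 2 * \<eta> * (\<delta> (Suc t) - L * \<alpha>\<^sup>2 / 2) + D (Suc t)"
      using G_ge \<eta>(1) by simp
    finally show ?thesis .
  qed

  \<comment> \<open>The feedback coefficient \<open>4 (\<eta> d L0 / \<alpha>)\<^sup>2\<close> is at most \<open>1 / 4\<close> by the first bound on \<open>\<eta>\<close>.\<close>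
  have variance: "D (Suc t) \<le> 4 * \<eta>\<^sup>2 * ?d * (n (Suc t) + n t) + D t / 4 + 4 * \<eta>\<^sup>2 * ?d\<^sup>2 * L\<^sup>2 * \<alpha>\<^sup>2"
    if t: "Suc t \<le> T" for t
  proof -
    define B where "B = (\<lambda>\<omega>. (u (Suc t) \<omega> \<bullet> g (X (Suc t) \<omega>))\<^sup>2 + (u t \<omega> \<bullet> g (X t \<omega>))\<^sup>2
      + (L0 / \<alpha>)\<^sup>2 * (norm (X (Suc t) \<omega> - X t \<omega>))\<^sup>2 + L\<^sup>2 * \<alpha>\<^sup>2)"
    have t': "t \<le> T" using t by simp
    have int_B: "integrable M B"
      unfolding B_def using int_ug[OF t] int_ug[OF t'] int_D[OF t'] by simp
    have "D (Suc t) \<le> expectation (\<lambda>\<omega>. \<eta>\<^sup>2 * (4 * ?d\<^sup>2 * B \<omega>))"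
      unfolding D_def
    proof (rule integral_mono_AE)
      show "AE \<omega> in M. (norm (X (Suc (Suc t)) \<omega> - X (Suc t) \<omega>))\<^sup>2 \<le> \<eta>\<^sup>2 * (4 * ?d\<^sup>2 * B \<omega>)"
        using u_norm
      proof eventually_elim
        case (elim \<omega>)
        have "(norm (X (Suc (Suc t)) \<omega> - X (Suc t) \<omega>))\<^sup>2
          = \<eta>\<^sup>2 * (norm (residual_grad f \<alpha> (X (Suc t) \<omega>) (u (Suc t) \<omega>) (X t \<omega>) (u t \<omega>)))\<^sup>2"
          by (simp add: X_step power_mult_distrib)
        also have "\<dots> \<le> \<eta>\<^sup>2 * (4 * ?d\<^sup>2 * B \<omega>)"
          unfolding B_def using elim t
          by (intro mult_left_mono residual_grad_norm_le[OF grad glip lip \<alpha>]) auto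
        finally show ?case .
      qed
    qed (use int_D[OF t] int_B in auto)
    also have "\<dots> = \<eta>\<^sup>2 * (4 * ?d\<^sup>2 * expectation B)"
      by simp
    also have "expectation B = n (Suc t) / ?d + n t / ?d + (L0 / \<alpha>)\<^sup>2 * D t + L\<^sup>2 * \<alpha>\<^sup>2"
      unfolding B_def using int_ug[OF t] int_ug[OF t'] int_D[OF t']
      by (simp add: second_moment[OF t] second_moment[OF t'] D_def prob_space)
    also have "\<eta>\<^sup>2 * (4 * ?d\<^sup>2 * \<dots>) = 4 * \<eta>\<^sup>2 * ?d * (n (Suc t) + n t)
        + 4 * (\<eta> * ?d * L0 / \<alpha>)\<^sup>2 * D t + 4 * \<eta>\<^sup>2 * ?d\<^sup>2 * L\<^sup>2 * \<alpha>\<^sup>2"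
      using d \<alpha> by (simp add: field_simps power2_eq_square)
    also have "4 * (\<eta> * ?d * L0 / \<alpha>)\<^sup>2 * D t \<le> 4 * (1 / 4)\<^sup>2 * D t"
    proof (intro mult_right_mono mult_left_mono power_mono \<eta>L0)
      show "0 \<le> \<eta> * ?d * L0 / \<alpha>"
        using \<eta>(1) d L0 \<alpha> by (intro divide_nonneg_nonneg mult_nonneg_nonneg) auto
      show "0 \<le> D t"
        unfolding D_def by (intro integral_nonneg_AE) auto
    qed auto
    finally show ?thesis by (simp add: power2_eq_square)
  qed

  have "(\<Sum>t=1..T. \<delta> t) / T \<le> R 1 / (\<eta> * T) + 20 * \<eta> * ?d\<^sup>2 * L\<^sup>2 * \<alpha>\<^sup>2 + L * \<alpha>\<^sup>2 / 2"
  proof (rule averaged_descent_bound[OF \<eta>(1) \<eta>L d L T, where D = D and n = n])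
    show "0 \<le> R t" "0 \<le> D t" "0 \<le> n t" for t
      unfolding R_def D_def n_def by (auto intro!: integral_nonneg_AE)
    \<comment> \<open>The algorithm starts with two equal iterates, so the feedback recursion starts from 0.\<close>
    show "D 0 = 0" "n 0 = n 1"
      by (simp_all add: D_def n_def X1)
    fix t assume t: "1 \<le> t" "t \<le> T"
    then obtain k where k: "t = Suc k" "Suc k \<le> T"
      by (cases t) auto
    show "R (Suc t) \<le> R t - 2 * \<eta> * (\<delta> t - L * \<alpha>\<^sup>2 / 2) + D t"
      using descent[OF k(2)] by (simp only: k(1))
    show "D t \<le> 4 * \<eta>\<^sup>2 * ?d * (n t + n (t - 1)) + D (t - 1) / 4 + 4 * \<eta>\<^sup>2 * ?d\<^sup>2 * L\<^sup>2 * \<alpha>\<^sup>2"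
      using variance[OF k(2)] by (simp add: k(1))
    have "n t \<le> expectation (\<lambda>\<omega>. 2 * L * (f (X t \<omega>) - f xstar))"
      unfolding n_def using g_sq int_g[OF t(2)] int_f[OF t(2)] by (intro integral_mono) auto
    then show "n t \<le> 2 * L * \<delta> t"
      by (simp add: \<delta>_def)
  qed
  moreover have "R 1 = (norm (x1 - xstar))\<^sup>2"
    by (simp add: R_def X1 prob_space)
  moreover have "0 \<le> 16 * \<eta> * ?d * L0\<^sup>2 / T"
    using \<eta>(1) by simp
  ultimately show ?thesis
    by (simp add: \<delta>_def X_def)
qed

end
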